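(* For an integer $m\ge2$ let $S_m^4:=\{x_1^4+\cdots+x_m^4 : x_1,\dots,x_m\in\mathbb{Z}_{\ge0}\}$ and $R(S_m^4):=\{a/b: a,b\in S_m^4,\ b\neq0\}$. For all prime numbers $p>2$: (a) $R(S_2^4)$ is dense in $\mathbb{Q}_p$ if and only if $p\equiv1\pmod 8$. (b) $R(S_3^4)$ is dense in $\mathbb{Q}_p$ if and only if $p\neq5,29$. (c) $R(S_4^4)$ is dense in $\mathbb{Q}_p$ if and only if $p\neq5$. (d) $R(S_m^4)$ is dense in $\mathbb{Q}_p$ for all integers $m\ge5$. *)

theory Defs
  imports "HOL-Analysis.Analysis" "HOL-Computational_Algebra.Primes" "HOL-Number_Theory.Cong"
begin

section \<open>Completion of a metric space by classes of Cauchy sequences\<close>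

context Metric_space
begin

definition cauchy_equiv :: "((nat \<Rightarrow> 'a) \<times> (nat \<Rightarrow> 'a)) set" where
  "cauchy_equiv = {(\<sigma>, \<tau>). MCauchy \<sigma> \<and> MCauchy \<tau> \<and> (\<lambda>n. d (\<sigma> n) (\<tau> n)) \<longlonglongrightarrow> 0}"

definition completion :: "(nat \<Rightarrow> 'a) set set" where
  "completion = {\<sigma>. MCauchy \<sigma>} // cauchy_equiv"

text \<open>The value 0 outside the carrier only serves the locale \<^locale>\<open>Metric_space\<close>, which asks
  distances to be nonnegative on the whole type.\<close>

definition completion_dist :: "(nat \<Rightarrow> 'a) set \<Rightarrow> (nat \<Rightarrow> 'a) set \<Rightarrow> real" where
  "completion_dist X Y =
     (if X \<in> completion \<and> Y \<in> completion
      then THE l. \<forall>\<sigma>\<in>X. \<forall>\<tau>\<in>Y. (\<lambda>n. d (\<sigma> n) (\<tau> n)) \<longlonglongrightarrow> l else 0)"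

definition completion_embed :: "'a \<Rightarrow> (nat \<Rightarrow> 'a) set" where
  "completion_embed x = cauchy_equiv `` {\<lambda>n. x}"

lemma MCauchy_in: "MCauchy \<sigma> \<Longrightarrow> \<sigma> n \<in> M"
  by (auto simp: MCauchy_def)

lemma dist_tendsto_0_trans:
  assumes "\<And>n. \<rho> n \<in> M" "\<And>n. \<sigma> n \<in> M" "\<And>n. \<tau> n \<in> M"
    and "(\<lambda>n. d (\<rho> n) (\<sigma> n)) \<longlonglongrightarrow> 0" "(\<lambda>n. d (\<sigma> n) (\<tau> n)) \<longlonglongrightarrow> 0"
  shows "(\<lambda>n. d (\<rho> n) (\<tau> n)) \<longlonglongrightarrow> 0"
proof (rule tendsto_sandwich[OF _ _ tendsto_const])
  show "(\<lambda>n. d (\<rho> n) (\<sigma> n) + d (\<sigma> n) (\<tau> n)) \<longlonglongrightarrow> 0"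
    using tendsto_add[OF assms(4,5)] by simp
qed (use assms triangle in auto)

lemma equiv_cauchy_equiv: "equiv {\<sigma>. MCauchy \<sigma>} cauchy_equiv"
proof (rule equivI)
  show "cauchy_equiv \<subseteq> {\<sigma>. MCauchy \<sigma>} \<times> {\<sigma>. MCauchy \<sigma>}"
    by (auto simp: cauchy_equiv_def)
  show "refl_on {\<sigma>. MCauchy \<sigma>} cauchy_equiv"
    by (auto simp: refl_on_def cauchy_equiv_def MCauchy_in)
  show "sym cauchy_equiv"
    by (auto simp: sym_def cauchy_equiv_def commute)
  show "trans cauchy_equiv"
    unfolding trans_def cauchy_equiv_def using dist_tendsto_0_trans MCauchy_in by blast
qed

lemma MCauchy_dist_convergent:
  assumes "MCauchy \<sigma>" "MCauchy \<tau>"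
  shows "convergent (\<lambda>n. d (\<sigma> n) (\<tau> n))"
  unfolding Cauchy_convergent_iff[symmetric]
proof (rule metric_CauchyI)
  fix e :: real assume "e > 0"
  then obtain N1 N2 where
    N: "\<And>m n. m \<ge> N1 \<Longrightarrow> n \<ge> N1 \<Longrightarrow> d (\<sigma> m) (\<sigma> n) < e/2"
       "\<And>m n. m \<ge> N2 \<Longrightarrow> n \<ge> N2 \<Longrightarrow> d (\<tau> m) (\<tau> n) < e/2"
    using assms unfolding MCauchy_def by (meson half_gt_zero)
  have "dist (d (\<sigma> m) (\<tau> m)) (d (\<sigma> n) (\<tau> n)) < e" if "m \<ge> max N1 N2" "n \<ge> max N1 N2" for m n
  proof -
    have "d (\<sigma> m) (\<sigma> n) < e/2" "d (\<tau> m) (\<tau> n) < e/2" using N that by auto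
    moreover have "d (\<sigma> m) (\<tau> m) \<le> d (\<sigma> m) (\<sigma> n) + d (\<sigma> n) (\<tau> n) + d (\<tau> m) (\<tau> n)"
      "d (\<sigma> n) (\<tau> n) \<le> d (\<sigma> m) (\<sigma> n) + d (\<sigma> m) (\<tau> m) + d (\<tau> m) (\<tau> n)"
      using MCauchy_in[OF assms(1)] MCauchy_in[OF assms(2)] by (smt (verit) triangle commute)+
    ultimately show ?thesis by (simp add: dist_real_def)
  qed
  then show "\<exists>M. \<forall>m\<ge>M. \<forall>n\<ge>M. dist (d (\<sigma> m) (\<tau> m)) (d (\<sigma> n) (\<tau> n)) < e" by blast
qed

lemma completion_cases:
  assumes "X \<in> completion"
  obtains \<sigma> where "MCauchy \<sigma>" "X = cauchy_equiv `` {\<sigma>}" "\<sigma> \<in> X"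
  using assms equiv_class_self[OF equiv_cauchy_equiv] unfolding completion_def
  by (metis mem_Collect_eq quotientE)

lemma completionI: "MCauchy \<sigma> \<Longrightarrow> cauchy_equiv `` {\<sigma>} \<in> completion"
  by (simp add: completion_def quotientI)

lemma class_self: "MCauchy \<sigma> \<Longrightarrow> \<sigma> \<in> cauchy_equiv `` {\<sigma>}"
  using equiv_class_self[OF equiv_cauchy_equiv] by simp

lemma completion_dist_tendsto:
  assumes "X \<in> completion" "Y \<in> completion" "\<sigma> \<in> X" "\<tau> \<in> Y"
  shows "(\<lambda>n. d (\<sigma> n) (\<tau> n)) \<longlonglongrightarrow> completion_dist X Y"
proof -
  obtain \<sigma>0 \<tau>0 where s0: "MCauchy \<sigma>0" "X = cauchy_equiv `` {\<sigma>0}" "\<sigma>0 \<in> X"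
     and t0: "MCauchy \<tau>0" "Y = cauchy_equiv `` {\<tau>0}" "\<tau>0 \<in> Y"
    using completion_cases assms by metis
  obtain l where l: "(\<lambda>n. d (\<sigma>0 n) (\<tau>0 n)) \<longlonglongrightarrow> l"
    using MCauchy_dist_convergent s0 t0 by (auto simp: convergent_def)
  have all: "(\<lambda>n. d (\<sigma> n) (\<tau> n)) \<longlonglongrightarrow> l" if "\<sigma> \<in> X" "\<tau> \<in> Y" for \<sigma> \<tau>
  proof -
    have s: "MCauchy \<sigma>" "(\<lambda>n. d (\<sigma>0 n) (\<sigma> n)) \<longlonglongrightarrow> 0" and t: "MCauchy \<tau>" "(\<lambda>n. d (\<tau>0 n) (\<tau> n)) \<longlonglongrightarrow> 0"
      using that s0 t0 by (auto simp: cauchy_equiv_def)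
    have "(\<lambda>n. d (\<sigma> n) (\<tau> n) - d (\<sigma>0 n) (\<tau>0 n)) \<longlonglongrightarrow> 0"
    proof (rule Lim_null_comparison)
      have "norm (d (\<sigma> n) (\<tau> n) - d (\<sigma>0 n) (\<tau>0 n)) \<le> d (\<sigma>0 n) (\<sigma> n) + d (\<tau>0 n) (\<tau> n)" for n
        using MCauchy_in[OF s(1), of n] MCauchy_in[OF t(1), of n]
           MCauchy_in[OF s0(1), of n] MCauchy_in[OF t0(1), of n]
        unfolding real_norm_def by (smt (verit) triangle commute)
      then show "\<forall>\<^sub>F n in sequentially.
         norm (d (\<sigma> n) (\<tau> n) - d (\<sigma>0 n) (\<tau>0 n)) \<le> d (\<sigma>0 n) (\<sigma> n) + d (\<tau>0 n) (\<tau> n)" by simp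
      show "(\<lambda>n. d (\<sigma>0 n) (\<sigma> n) + d (\<tau>0 n) (\<tau> n)) \<longlonglongrightarrow> 0"
        using tendsto_add[OF s(2) t(2)] by simp
    qed
    from tendsto_add[OF this l] show ?thesis by simp
  qed
  have "completion_dist X Y = l"
    unfolding completion_dist_def using assms(1,2) all s0(3) t0(3)
    by (auto intro!: the_equality) (meson LIMSEQ_unique l)
  with all assms show ?thesis by simp
qed

theorem Metric_space_completion: "Metric_space completion completion_dist"
proof
  fix X Y
  show "0 \<le> completion_dist X Y"
  proof (cases "X \<in> completion \<and> Y \<in> completion")
    case True
    then obtain \<sigma> \<tau> where "\<sigma> \<in> X" "\<tau> \<in> Y" using completion_cases by metis
    with True completion_dist_tendsto have "(\<lambda>n. d (\<sigma> n) (\<tau> n)) \<longlonglongrightarrow> completion_dist X Y" by blast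
    then show ?thesis by (rule LIMSEQ_le_const) auto
  qed (auto simp: completion_dist_def)
  show "completion_dist X Y = completion_dist Y X"
  proof -
    have "(\<forall>\<sigma>\<in>X. \<forall>\<tau>\<in>Y. (\<lambda>n. d (\<sigma> n) (\<tau> n)) \<longlonglongrightarrow> l) = (\<forall>\<sigma>\<in>Y. \<forall>\<tau>\<in>X. (\<lambda>n. d (\<sigma> n) (\<tau> n)) \<longlonglongrightarrow> l)" for l
      by (subst commute) blast
    then show ?thesis by (simp add: completion_dist_def conj_commute)
  qed
next
  fix X Y assume XY: "X \<in> completion" "Y \<in> completion"
  obtain \<sigma> \<tau> where s: "MCauchy \<sigma>" "X = cauchy_equiv `` {\<sigma>}" "\<sigma> \<in> X"
     and t: "MCauchy \<tau>" "Y = cauchy_equiv `` {\<tau>}" "\<tau> \<in> Y"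
    using completion_cases XY by metis
  have lim: "(\<lambda>n. d (\<sigma> n) (\<tau> n)) \<longlonglongrightarrow> completion_dist X Y"
    using completion_dist_tendsto XY s t by blast
  have "X = Y \<longleftrightarrow> (\<sigma>, \<tau>) \<in> cauchy_equiv"
    using eq_equiv_class_iff[OF equiv_cauchy_equiv] s t by simp
  also have "\<dots> \<longleftrightarrow> (\<lambda>n. d (\<sigma> n) (\<tau> n)) \<longlonglongrightarrow> 0"
    using s t by (simp add: cauchy_equiv_def)
  also have "\<dots> \<longleftrightarrow> completion_dist X Y = 0"
    using lim LIMSEQ_unique by metis
  finally show "completion_dist X Y = 0 \<longleftrightarrow> X = Y" by simp
next
  fix X Y Z assume XYZ: "X \<in> completion" "Y \<in> completion" "Z \<in> completion"
  obtain \<rho> \<sigma> \<tau> where r: "MCauchy \<rho>" "\<rho> \<in> X" and s: "MCauchy \<sigma>" "\<sigma> \<in> Y" and t: "MCauchy \<tau>" "\<tau> \<in> Z"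
    using completion_cases XYZ by metis
  have "(\<lambda>n. d (\<rho> n) (\<sigma> n) + d (\<sigma> n) (\<tau> n)) \<longlonglongrightarrow> completion_dist X Y + completion_dist Y Z"
    by (intro tendsto_add completion_dist_tendsto XYZ r s t)
  moreover have "(\<lambda>n. d (\<rho> n) (\<tau> n)) \<longlonglongrightarrow> completion_dist X Z"
    by (intro completion_dist_tendsto XYZ r s t)
  ultimately show "completion_dist X Z \<le> completion_dist X Y + completion_dist Y Z"
    using triangle MCauchy_in[OF r(1)] MCauchy_in[OF s(1)] MCauchy_in[OF t(1)]
    by (intro LIMSEQ_le) auto
qed

lemma MCauchy_const': "x \<in> M \<Longrightarrow> MCauchy (\<lambda>n. x)"
  by (auto simp: MCauchy_def)

lemma completion_embed_in: "x \<in> M \<Longrightarrow> completion_embed x \<in> completion"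
  unfolding completion_embed_def by (intro completionI MCauchy_const')

lemma completion_embed_isometry:
  assumes "x \<in> M" "y \<in> M"
  shows "completion_dist (completion_embed x) (completion_embed y) = d x y"
proof -
  have "(\<lambda>n::nat. d x y) \<longlonglongrightarrow> completion_dist (completion_embed x) (completion_embed y)"
    using completion_dist_tendsto[OF completion_embed_in completion_embed_in, of x y "\<lambda>n. x" "\<lambda>n. y"]
    using assms class_self MCauchy_const' by (simp add: completion_embed_def)
  then show ?thesis by (simp add: LIMSEQ_const_iff)
qed

lemma completion_approx:
  assumes "MCauchy \<sigma>"
  shows "(\<lambda>m. completion_dist (completion_embed (\<sigma> m)) (cauchy_equiv `` {\<sigma>})) \<longlonglongrightarrow> 0"
proof (rule LIMSEQ_I)
  fix e :: real assume "e > 0"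
  then obtain N where N: "\<And>m n. m \<ge> N \<Longrightarrow> n \<ge> N \<Longrightarrow> d (\<sigma> m) (\<sigma> n) < e/2"
    using assms unfolding MCauchy_def by (meson half_gt_zero)
  have "norm (completion_dist (completion_embed (\<sigma> m)) (cauchy_equiv `` {\<sigma>}) - 0) < e" if "m \<ge> N" for m
  proof -
    have "(\<lambda>n. d (\<sigma> m) (\<sigma> n)) \<longlonglongrightarrow> completion_dist (completion_embed (\<sigma> m)) (cauchy_equiv `` {\<sigma>})"
      using completion_dist_tendsto[OF completion_embed_in completionI, of "\<sigma> m" \<sigma> "\<lambda>n. \<sigma> m" \<sigma>]
      using assms class_self MCauchy_const' MCauchy_in[OF assms] by (simp add: completion_embed_def)
    moreover have "\<exists>K. \<forall>n\<ge>K. d (\<sigma> m) (\<sigma> n) \<le> e/2"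
      using N[OF that] by (meson less_imp_le)
    ultimately have "completion_dist (completion_embed (\<sigma> m)) (cauchy_equiv `` {\<sigma>}) \<le> e/2"
      by (rule LIMSEQ_le_const2)
    then show ?thesis
      using \<open>e > 0\<close> Metric_space.nonneg[OF Metric_space_completion] by (smt (verit) field_sum_of_halves real_norm_def)
  qed
  then show "\<exists>N. \<forall>m\<ge>N. norm (completion_dist (completion_embed (\<sigma> m)) (cauchy_equiv `` {\<sigma>}) - 0) < e"
    by blast
qed

lemma completion_approx_ex:
  assumes "X \<in> completion" "e > 0"
  obtains x where "x \<in> M" "completion_dist (completion_embed x) X < e"
proof -
  obtain \<sigma> where s: "MCauchy \<sigma>" "X = cauchy_equiv `` {\<sigma>}" using completion_cases assms by metis
  have "\<forall>\<^sub>F m in sequentially. completion_dist (completion_embed (\<sigma> m)) X < e"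
    using order_tendstoD(2)[OF completion_approx[OF s(1)] assms(2)] s(2) by simp
  then obtain m where "completion_dist (completion_embed (\<sigma> m)) X < e"
    using eventually_happens'[OF sequentially_bot] by blast
  with that MCauchy_in[OF s(1)] show ?thesis by blast
qed

theorem completion_embed_dense:
  "Metric_space.mtopology completion completion_dist closure_of (completion_embed ` M) = completion"
proof -
  interpret C: Metric_space completion completion_dist by (rule Metric_space_completion)
  have "\<exists>y\<in>completion_embed ` M. y \<in> C.mball X r" if "X \<in> completion" "r > 0" for X r
    using completion_approx_ex[OF that] that completion_embed_in
    by (metis C.commute C.in_mball image_eqI)
  then show ?thesis
    by (auto simp: C.metric_closure_of)
qed

theorem mcomplete_completion: "Metric_space.mcomplete completion completion_dist"
proof -
  interpret C: Metric_space completion completion_dist by (rule Metric_space_completion)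
  show ?thesis
    unfolding C.mcomplete_def
  proof (intro allI impI)
    fix X assume X: "C.MCauchy X"
    then have Xin: "\<And>n. X n \<in> completion" by (rule C.MCauchy_in)
    have "\<exists>x. x \<in> M \<and> completion_dist (completion_embed x) (X n) < 1 / real (Suc n)" for n
      using completion_approx_ex[OF Xin[of n], of "1 / real (Suc n)"] by auto
    then obtain x where x: "\<And>n. x n \<in> M" "\<And>n. completion_dist (completion_embed (x n)) (X n) < 1 / real (Suc n)"
      by metis
    have lim0: "(\<lambda>n. completion_dist (completion_embed (x n)) (X n)) \<longlonglongrightarrow> 0"
      by (rule tendsto_sandwich[OF _ _ tendsto_const LIMSEQ_inverse_real_of_nat])
         (use x(2) in \<open>auto intro!: always_eventually less_imp_le simp: inverse_eq_divide\<close>)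
    have ex: "\<And>n. completion_embed (x n) \<in> completion" using x completion_embed_in by blast
    have "MCauchy x"
      unfolding MCauchy_def
    proof (intro conjI allI impI)
      fix e :: real assume e: "e > 0"
      obtain N1 where N1: "\<And>m n. m \<ge> N1 \<Longrightarrow> n \<ge> N1 \<Longrightarrow> completion_dist (X m) (X n) < e/3"
        using X e unfolding C.MCauchy_def by (metis divide_pos_pos zero_less_numeral)
      obtain N2 where N2: "\<And>n. n \<ge> N2 \<Longrightarrow> completion_dist (completion_embed (x n)) (X n) < e/3"
        using order_tendstoD(2)[OF lim0, of "e/3"] e by (auto simp: eventually_sequentially)
      have "d (x m) (x n) < e" if "m \<ge> max N1 N2" "n \<ge> max N1 N2" for m n
      proof -
        have "d (x m) (x n) = completion_dist (completion_embed (x m)) (completion_embed (x n))"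
          using completion_embed_isometry x by simp
        also have "\<dots> \<le> completion_dist (completion_embed (x m)) (X m) + completion_dist (X m) (X n)
               + completion_dist (completion_embed (x n)) (X n)"
          using C.triangle[OF ex[of m] Xin[of m] ex[of n]] C.triangle[OF Xin[of m] Xin[of n] ex[of n]]
          by (simp add: C.commute)
        also have "\<dots> < e" using N1[of m n] N2[of m] N2[of n] that by simp
        finally show ?thesis .
      qed
      then show "\<exists>N. \<forall>n n'. N \<le> n \<longrightarrow> N \<le> n' \<longrightarrow> d (x n) (x n') < e" by blast
    qed (use x in auto)
    define L where "L = cauchy_equiv `` {x}"
    have Lin: "L \<in> completion" unfolding L_def by (rule completionI) fact
    have "(\<lambda>n. completion_dist (X n) L) \<longlonglongrightarrow> 0"
    proof (rule C.dist_tendsto_0_trans[OF Xin ex])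
      show "(\<lambda>n. completion_dist (X n) (completion_embed (x n))) \<longlonglongrightarrow> 0"
        using lim0 by (simp add: C.commute)
      show "(\<lambda>n. completion_dist (completion_embed (x n)) L) \<longlonglongrightarrow> 0"
        unfolding L_def by (rule completion_approx) fact
    qed (rule Lin)
    then have "limitin C.mtopology X L sequentially"
      using Xin Lin by (simp add: C.limitin_metric_dist_null)
    then show "\<exists>L. limitin C.mtopology X L sequentially" ..
  qed
qed

end


section \<open>The field of p-adic numbers as a metric space\<close>

text \<open>Only meaningful for nonzero arguments.\<close>

definition padic_val :: "nat \<Rightarrow> rat \<Rightarrow> int" where
  "padic_val p x = (case quotient_of x of
     (a, b) \<Rightarrow> int (multiplicity (int p) a) - int (multiplicity (int p) b))"

definition padic_abs :: "nat \<Rightarrow> rat \<Rightarrow> real" where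
  "padic_abs p x = (if x = 0 then 0 else real p powi (- padic_val p x))"

definition padic_dist :: "nat \<Rightarrow> rat \<Rightarrow> rat \<Rightarrow> real" where
  "padic_dist p x y = padic_abs p (x - y)"

definition Qp :: "nat \<Rightarrow> (nat \<Rightarrow> rat) set set" where
  "Qp p = Metric_space.completion UNIV (padic_dist p)"

definition Qp_dist :: "nat \<Rightarrow> (nat \<Rightarrow> rat) set \<Rightarrow> (nat \<Rightarrow> rat) set \<Rightarrow> real" where
  "Qp_dist p = Metric_space.completion_dist UNIV (padic_dist p)"

definition Qp_of_rat :: "nat \<Rightarrow> rat \<Rightarrow> (nat \<Rightarrow> rat) set" where
  "Qp_of_rat p = Metric_space.completion_embed UNIV (padic_dist p)"

definition Qp_topology :: "nat \<Rightarrow> (nat \<Rightarrow> rat) set topology" where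
  "Qp_topology p = Metric_space.mtopology (Qp p) (Qp_dist p)"

definition dense_in_Qp :: "nat \<Rightarrow> rat set \<Rightarrow> bool" where
  "dense_in_Qp p A \<longleftrightarrow> Qp_topology p closure_of (Qp_of_rat p ` A) = Qp p"

lemma padic_val_fract:
  assumes "prime p" "a \<noteq> 0" "b \<noteq> 0"
  shows "padic_val p (of_int a / of_int b) =
           int (multiplicity (int p) a) - int (multiplicity (int p) b)"
proof -
  obtain c e where q: "quotient_of (of_int a / of_int b) = (c, e)" by fastforce
  have e: "e > 0" using q by (rule quotient_of_denom_pos)
  have eq: "(of_int a / of_int b :: rat) = of_int c / of_int e" using q by (rule quotient_of_div)
  then have "(of_int (a * e) :: rat) = of_int (c * b)"
    using e assms by (simp add: field_simps)
  then have ae: "a * e = c * b" by (simp only: of_int_eq_iff)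
  then have c: "c \<noteq> 0" using assms e by auto
  have pr: "prime_elem (int p)" using assms(1) by simp
  have "multiplicity (int p) a + multiplicity (int p) e = multiplicity (int p) c + multiplicity (int p) b"
    using arg_cong[OF ae, of "multiplicity (int p)"] c e assms
    by (simp add: prime_elem_multiplicity_mult_distrib[OF pr])
  then show ?thesis unfolding padic_val_def q by simp
qed

lemma rat_fract_ex:
  obtains a b :: int where "x = (of_int a / of_int b :: rat)" "b \<noteq> 0"
  by (metis quotient_of_denom_pos quotient_of_div surj_pair less_irrefl)

lemma padic_val_minus: "prime p \<Longrightarrow> x \<noteq> 0 \<Longrightarrow> padic_val p (- x) = padic_val p x"
proof -
  assume p: "prime p" and x: "x \<noteq> 0"
  obtain a b where ab: "x = (of_int a / of_int b :: rat)" "b \<noteq> 0" by (rule rat_fract_ex)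
  with x have a: "a \<noteq> 0" by auto
  have "- x = of_int (- a) / of_int b" using ab by simp
  then show ?thesis
    using padic_val_fract[OF p a ab(2)] padic_val_fract[OF p _ ab(2), of "-a"] a ab(1)
    by (metis multiplicity_normalize_right neg_equal_0_iff_equal normalize_int_def abs_minus)
qed

lemma padic_val_add:
  assumes p: "prime p" and x: "x \<noteq> 0" and y: "y \<noteq> 0" and xy: "x + y \<noteq> 0"
  shows "padic_val p (x + y) \<ge> min (padic_val p x) (padic_val p y)"
proof -
  obtain a b where ab: "x = (of_int a / of_int b :: rat)" "b \<noteq> 0" by (rule rat_fract_ex)
  obtain c e where ce: "y = (of_int c / of_int e :: rat)" "e \<noteq> 0" by (rule rat_fract_ex)
  have be: "b * e \<noteq> 0" using ab ce by simp
  have X: "x = of_int (a * e) / of_int (b * e)" and Y: "y = of_int (c * b) / of_int (b * e)"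
    and XY: "x + y = of_int (a * e + c * b) / of_int (b * e)"
    using ab ce by (simp_all add: field_simps)
  have nz: "a * e \<noteq> 0" "c * b \<noteq> 0" "a * e + c * b \<noteq> 0"
    using X Y XY x y xy by (metis div_0 of_int_0)+
  have nu: "\<not> is_unit (int p)" using p by (metis not_prime_unit prime_int_nat_transfer prime_nat_int_transfer)
  let ?k = "min (multiplicity (int p) (a * e)) (multiplicity (int p) (c * b))"
  have "int p ^ ?k dvd a * e + c * b"
    by (intro dvd_add multiplicity_dvd') auto
  then have "multiplicity (int p) (a * e + c * b) \<ge> ?k"
    using multiplicity_geI nz(3) nu by blast
  then show ?thesis
    unfolding X[THEN arg_cong[where f = "padic_val p"]] Y[THEN arg_cong[where f = "padic_val p"]]
      XY[THEN arg_cong[where f = "padic_val p"]] padic_val_fract[OF p nz(1) be]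
      padic_val_fract[OF p nz(2) be] padic_val_fract[OF p nz(3) be]
    by linarith
qed

lemma padic_abs_nonneg: "padic_abs p x \<ge> 0"
  by (simp add: padic_abs_def)

lemma padic_abs_eq_0: "prime p \<Longrightarrow> padic_abs p x = 0 \<longleftrightarrow> x = 0"
  using prime_gt_0_nat[of p] by (simp add: padic_abs_def power_int_eq_0_iff)

lemma padic_abs_add: 
  assumes p: "prime p"
  shows "padic_abs p (x + y) \<le> max (padic_abs p x) (padic_abs p y)"
proof (cases "x = 0 \<or> y = 0 \<or> x + y = 0")
  case True
  then show ?thesis using padic_abs_nonneg[of p x] padic_abs_nonneg[of p y]
    by (auto simp: padic_abs_def[of p 0])
next
  case False
  have p1: "1 \<le> real p" using prime_gt_0_nat[OF p] by simp
  have "real p powi (- padic_val p (x + y)) \<le> real p powi (- min (padic_val p x) (padic_val p y))"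
    using padic_val_add[OF p, of x y] False p1 by (intro power_int_increasing) auto
  then show ?thesis using False
    by (auto simp: padic_abs_def min_def max_def split: if_splits)
qed

theorem Metric_space_padic:
  assumes p: "prime p"
  shows "Metric_space UNIV (padic_dist p)"
proof
  fix x y z
  show "0 \<le> padic_dist p x y" by (simp add: padic_dist_def padic_abs_nonneg)
  show "padic_dist p x y = padic_dist p y x"
    using padic_val_minus[OF p, of "x - y"] by (auto simp: padic_dist_def padic_abs_def)
  show "padic_dist p x y = 0 \<longleftrightarrow> x = y" by (simp add: padic_dist_def padic_abs_eq_0[OF p])
  show "padic_dist p x z \<le> padic_dist p x y + padic_dist p y z"
    using padic_abs_add[OF p, of "x - y" "y - z"] padic_abs_nonneg[of p "x - y"]
      padic_abs_nonneg[of p "y - z"] by (simp add: padic_dist_def)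
qed

theorem
  assumes p: "prime p"
  shows Metric_space_Qp: "Metric_space (Qp p) (Qp_dist p)"
    and mcomplete_Qp: "Metric_space.mcomplete (Qp p) (Qp_dist p)"
    and Qp_of_rat_isometry: "Qp_dist p (Qp_of_rat p x) (Qp_of_rat p y) = padic_dist p x y"
    and dense_in_Qp_UNIV: "dense_in_Qp p UNIV"
proof -
  interpret Metric_space UNIV "padic_dist p" using p by (rule Metric_space_padic)
  note defs = Qp_def Qp_dist_def Qp_of_rat_def Qp_topology_def dense_in_Qp_def
  show "Metric_space (Qp p) (Qp_dist p)"
    unfolding defs by (rule Metric_space_completion)
  show "Metric_space.mcomplete (Qp p) (Qp_dist p)"
    unfolding defs by (rule mcomplete_completion)
  show "Qp_dist p (Qp_of_rat p x) (Qp_of_rat p y) = padic_dist p x y"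
    unfolding defs by (rule completion_embed_isometry) auto
  show "dense_in_Qp p UNIV"
    unfolding defs by (rule completion_embed_dense)
qed


section \<open>Ratio sets of sums of fourth powers\<close>

definition sums_fourth_powers :: "nat \<Rightarrow> nat set" where
  "sums_fourth_powers m = {s. \<exists>x :: nat \<Rightarrow> nat. s = (\<Sum>i = 1..m. x i ^ 4)}"

definition ratio_set :: "nat set \<Rightarrow> rat set" where
  "ratio_set S = {of_nat a / of_nat b | a b. a \<in> S \<and> b \<in> S \<and> b \<noteq> 0}"

end

theory Submission
  imports Defs "HOL-Number_Theory.Residue_Primitive_Roots"
begin

text \<open>Density of the ratio set is equivalent to isotropy of \<open>x\<^sub>1\<^sup>4 + \<dots> + x\<^sub>m\<^sup>4\<close> modulo \<open>p\<close>.
  Given a nontrivial zero modulo \<open>p\<close>, Hensel lifting of one coordinate shows that every multiple of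
  \<open>p\<close> is a \<open>p\<close>-adic limit of sums of \<open>m\<close> fourth powers, and \<open>a/b = pa/pb\<close>. Without such a zero,
  all these sums have valuation divisible by 4, so that \<open>p\<close> itself cannot be approximated.

  For three variables the critical primes are \<open>p = 4f + 1\<close> with \<open>f\<close> odd. The numbers of solutions of
  \<open>x + y + z = 0\<close> with \<open>x, y, z\<close> in prescribed classes modulo the group \<open>H\<close> of fourth powers take only
  five values. Double counting gives three linear relations and, through the additive energy of
  \<open>H\<close>, a quadratic one. If \<open>x + y + z = 0\<close> had no solution in \<open>H\<close>, these relations would determine
  the remaining values up to a square that is nonnegative only for \<open>f \<in> {1, 4, 7}\<close>, that is
  \<open>p \<in> {5, 17, 29}\<close>, where 17 is excluded because \<open>f\<close> is odd.\<close>

section \<open>Density and isotropy modulo p\<close>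

text \<open>Rationals embed isometrically and densely, so it suffices to test the closure at
  rational points. From here on only \<open>padic_dist\<close> on the rationals is needed.\<close>

lemma dense_in_Qp_iff:
  assumes "prime p"
  shows "dense_in_Qp p A \<longleftrightarrow> (\<forall>x. \<forall>e>0. \<exists>a\<in>A. padic_dist p x a < e)"
proof -
  interpret P: Metric_space UNIV "padic_dist p" by (rule Metric_space_padic[OF assms])
  interpret Q: Metric_space "Qp p" "Qp_dist p" by (rule Metric_space_Qp[OF assms])
  have emb_in: "Qp_of_rat p x \<in> Qp p" for x
    unfolding Qp_of_rat_def Qp_def by (rule P.completion_embed_in) simp
  note iso = Qp_of_rat_isometry[OF assms]
  show ?thesis
  proof
    assume d: "dense_in_Qp p A"
    show "\<forall>x. \<forall>e>0. \<exists>a\<in>A. padic_dist p x a < e"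
    proof (intro allI impI)
      fix x and e :: real assume "e > 0"
      have "Qp_of_rat p x \<in> Q.mtopology closure_of (Qp_of_rat p ` A)"
        using d emb_in unfolding dense_in_Qp_def Qp_topology_def by simp
      then obtain y where "y \<in> Qp_of_rat p ` A" "y \<in> Q.mball (Qp_of_rat p x) e"
        using \<open>e > 0\<close> unfolding Q.metric_closure_of by blast
      then show "\<exists>a\<in>A. padic_dist p x a < e"
        using iso by (auto simp: Q.in_mball)
    qed
  next
    assume d: "\<forall>x. \<forall>e>0. \<exists>a\<in>A. padic_dist p x a < e"
    have "\<exists>y\<in>Qp_of_rat p ` A. y \<in> Q.mball X r" if X: "X \<in> Qp p" and r: "r > 0" for X r
    proof -
      obtain x where x: "Qp_dist p (Qp_of_rat p x) X < r/2"
        using P.completion_approx_ex[of X "r/2"] X r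
        unfolding Qp_def Qp_dist_def Qp_of_rat_def by auto
      obtain a where a: "a \<in> A" "padic_dist p x a < r/2" using d r by (meson half_gt_zero)
      have "Qp_dist p X (Qp_of_rat p a) < r"
        using Q.triangle[OF X emb_in[of x] emb_in[of a]] x a iso[of x a]
        by (simp add: Q.commute[of X "Qp_of_rat p x"])
      then show ?thesis using a X emb_in by (auto simp: Q.in_mball)
    qed
    then show "dense_in_Qp p A"
      unfolding dense_in_Qp_def Qp_topology_def Q.metric_closure_of by auto
  qed
qed

section \<open>Isotropy implies density\<close>

definition isotropic :: "nat \<Rightarrow> nat \<Rightarrow> bool" where
  "isotropic p m \<longleftrightarrow>
     (\<exists>x :: nat \<Rightarrow> nat. p dvd (\<Sum>i = 1..m. x i ^ 4) \<and> (\<exists>i\<in>{1..m}. \<not> p dvd x i))"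

text \<open>Hensel's lemma for \<open>Y ^ 4 - c\<close>: the root is simple modulo \<open>p\<close>,
  because its derivative \<open>4 * y ^ 3\<close> is a unit for odd \<open>p\<close> and
  \<open>y\<close> prime to \<open>p\<close>.\<close>

lemma fourth_power_lift:
  fixes c x :: int
  assumes p: "prime p" "p > (2::nat)" and x: "[x ^ 4 = c] (mod int p)" "\<not> int p dvd x"
  shows "\<exists>y. [y ^ 4 = c] (mod int p ^ Suc N)"
proof -
  have "\<exists>y. [y ^ 4 = c] (mod int p ^ Suc N) \<and> \<not> int p dvd y"
  proof (induction N)
    case 0
    then show ?case using x by auto
  next
    case (Suc N)
    then obtain y where y: "[y ^ 4 = c] (mod int p ^ Suc N)" "\<not> int p dvd y" by blast
    have "coprime (int p) (4 * y ^ 3)"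
    proof -
      have "coprime (int p) (2 ^ 2)" using p
        by (metis coprime_power_right_iff of_nat_numeral coprime_int_iff primes_coprime two_is_prime_nat less_irrefl)
      moreover have "coprime (int p) y" using p y(2) by (simp add: prime_imp_coprime)
      ultimately show ?thesis by simp
    qed
    then obtain z where z: "[4 * y ^ 3 * z = 1] (mod int p)"
      using cong_solve_coprime_int coprime_commute by blast
    obtain k where k: "c - y ^ 4 = int p ^ Suc N * k"
      using y(1) by (meson cong_iff_dvd_diff cong_sym dvdE)
    define q where "q = int p ^ Suc N"
    define w where "w = y + q * (z * k)"
    have "w ^ 4 - c = q * k * (4 * y ^ 3 * z - 1) + q * q * (6 * y ^ 2 * (z * k)^2 + 4 * y * q * (z * k)^3 + q ^ 2 * (z * k) ^ 4)"
    proof -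
      have "c = y ^ 4 + q * k" using k by (simp add: q_def)
      then show ?thesis unfolding w_def
        by (simp add: power4_eq_xxxx power3_eq_cube power2_eq_square algebra_simps)
    qed
    moreover have "int p ^ Suc (Suc N) dvd q * k * (4 * y ^ 3 * z - 1)"
    proof -
      have "int p dvd 4 * y ^ 3 * z - 1" using z by (simp add: cong_iff_dvd_diff)
      then have "q * int p dvd q * (k * (4 * y ^ 3 * z - 1))" by simp
      then show ?thesis by (simp add: q_def mult.assoc mult.commute)
    qed
    moreover have "int p ^ Suc (Suc N) dvd q * q * (6 * y ^ 2 * (z * k)^2 + 4 * y * q * (z * k)^3 + q ^ 2 * (z * k) ^ 4)"
    proof -
      have "int p ^ Suc (Suc N) dvd q * q"
        unfolding q_def power_add[symmetric] by (rule le_imp_power_dvd) simp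
      then show ?thesis by (rule dvd_mult2)
    qed
    ultimately have "[w ^ 4 = c] (mod int p ^ Suc (Suc N))"
      unfolding cong_iff_dvd_diff by (metis dvd_add)
    moreover have "\<not> int p dvd w"
      using y(2) unfolding w_def q_def by (simp add: dvd_add_left_iff)
    ultimately show ?case by blast
  qed
  then show ?thesis by blast
qed

text \<open>All coordinates of the zero are kept except one that is prime to \<open>p\<close>; that
  one is lifted to absorb \<open>n\<close>. As \<open>p\<close> divides \<open>n\<close>, its old
  value solves the equation modulo \<open>p\<close>.\<close>

lemma sums_fourth_powers_approx:
  assumes p: "prime p" "p > 2" and iso: "isotropic p m" and n: "int p dvd n"
  shows "\<exists>s\<in>sums_fourth_powers m. [int s = n] (mod int p ^ N)"
proof -
  obtain x i where x: "p dvd (\<Sum>i = 1..m. x i ^ 4)" "i \<in> {1..m}" "\<not> p dvd x i"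
    using iso unfolding isotropic_def by blast
  define R where "R = (\<Sum>j\<in>{1..m} - {i}. x j ^ 4)"
  have split: "(\<Sum>j = 1..m. x j ^ 4) = x i ^ 4 + R"
    unfolding R_def using x(2) by (subst sum.remove[of _ i]) auto
  have "[int (x i) ^ 4 = n - int R] (mod int p)"
  proof -
    have "int p dvd int (x i ^ 4 + R)" using x(1) split by (simp only: int_dvd_int_iff)
    then have "int p dvd int (x i ^ 4 + R) - n" using n by (rule dvd_diff)
    then show ?thesis by (simp add: cong_iff_dvd_diff algebra_simps)
  qed
  then obtain y where y: "[y ^ 4 = n - int R] (mod int p ^ Suc N)"
    using fourth_power_lift[OF p] x(3) by (metis int_dvd_int_iff)
  define z where "z = nat \<bar>y\<bar>"
  have z4: "int z ^ 4 = y ^ 4" by (simp add: z_def power_even_abs)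
  define s where "s = (\<Sum>j = 1..m. (x(i := z)) j ^ 4)"
  have "s = z ^ 4 + R"
    unfolding s_def R_def using x(2) by (subst sum.remove[of _ i]) auto
  then have "int s - n = y ^ 4 - (n - int R)" using z4 by simp
  then have "[int s = n] (mod int p ^ Suc N)" using y unfolding cong_iff_dvd_diff by (simp only:)
  then have "[int s = n] (mod int p ^ N)" by (rule cong_dvd_modulus) simp
  moreover have "s \<in> sums_fourth_powers m" unfolding sums_fourth_powers_def s_def by blast
  ultimately show ?thesis by blast
qed

text \<open>The valuation of the denominator is at most \<open>k\<close>. The bound \<open>N\<close>
  depends only on \<open>e\<close> and \<open>k\<close>, so it can be fixed before the approximating
  sums are chosen.\<close>

lemma padic_abs_less_if_dvd:
  assumes p: "prime p" and "e > 0"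
  shows "\<exists>N. \<forall>a b::int. b \<noteq> 0 \<longrightarrow> int p ^ N dvd a \<longrightarrow> \<not> int p ^ Suc k dvd b \<longrightarrow>
           padic_abs p (of_int a / of_int b) < e"
proof -
  have p1: "1 < real p" using prime_gt_1_nat[OF p] by simp
  obtain N0 where N0: "1 / e < real p ^ N0" using real_arch_pow[OF p1] by blast
  have "padic_abs p (of_int a / of_int b) < e"
    if b: "b \<noteq> 0" and a: "int p ^ (N0 + k) dvd a" and nb: "\<not> int p ^ Suc k dvd b" for a b :: int
  proof (cases "a = 0")
    case False
    have nu: "\<not> is_unit (int p)" using prime_gt_1_nat[OF p] by simp
    have "multiplicity (int p) a \<ge> N0 + k" using False a nu by (intro multiplicity_geI) auto
    moreover have "multiplicity (int p) b < Suc k" using nb b nu by (intro multiplicity_lessI) auto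
    ultimately have "padic_val p (of_int a / of_int b) \<ge> int N0"
      unfolding padic_val_fract[OF p False b] by simp
    then have "real p powi (- padic_val p (of_int a / of_int b)) \<le> real p powi (- int N0)"
      using p1 by (intro power_int_increasing) auto
    also have "\<dots> < e" using N0 \<open>e > 0\<close> p1 by (simp add: power_int_minus field_simps)
    finally show ?thesis using False b by (simp add: padic_abs_def)
  qed (use \<open>e > 0\<close> in \<open>simp add: padic_abs_def\<close>)
  then show ?thesis by blast
qed

lemma dense_if_isotropic:
  assumes p: "prime p" "p > 2" and iso: "isotropic p m"
  shows "dense_in_Qp p (ratio_set (sums_fourth_powers m))"
  unfolding dense_in_Qp_iff[OF p(1)]
proof (intro allI impI)
  fix r :: rat and e :: real assume e: "e > 0"
  obtain a b where ab: "r = of_int a / of_int b" "b \<noteq> 0" by (rule rat_fract_ex)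
  have nu: "\<not> is_unit (int p)" and p0: "p \<noteq> 0" using prime_gt_1_nat[OF p(1)] by auto
  \<comment> \<open>The denominator of the error \<open>r - s / t\<close> is \<open>t * b\<close>,
    where \<open>t\<close> will approximate \<open>p * b\<close>. Agreement modulo
    \<open>p ^ Suc k\<close> keeps its valuation at \<open>k\<close> and forces \<open>t\<close> to
    be nonzero.\<close>
  define k where "k = multiplicity (int p) (int p * b * b)"
  have nd: "\<not> int p ^ Suc k dvd int p * b * b"
    using ab(2) p0 nu unfolding k_def
    by (subst power_dvd_iff_le_multiplicity) auto
  obtain N where N: "\<And>a b::int. b \<noteq> 0 \<Longrightarrow> int p ^ N dvd a \<Longrightarrow> \<not> int p ^ Suc k dvd b \<Longrightarrow>
           padic_abs p (of_int a / of_int b) < e"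
    using padic_abs_less_if_dvd[OF p(1) e] by blast
  define M where "M = N + Suc k"
  obtain s where s: "s \<in> sums_fourth_powers m" "[int s = int p * a] (mod int p ^ M)"
    using sums_fourth_powers_approx[OF p iso] by (meson dvd_triv_left)
  obtain t where t: "t \<in> sums_fourth_powers m" "[int t = int p * b] (mod int p ^ M)"
    using sums_fourth_powers_approx[OF p iso] by (meson dvd_triv_left)
  have "[int t * b = int p * b * b] (mod int p ^ M)" using t(2) by (rule cong_scalar_right)
  then have "[int t * b = int p * b * b] (mod int p ^ Suc k)"
    by (rule cong_dvd_modulus) (simp add: M_def le_imp_power_dvd)
  then have ntb: "\<not> int p ^ Suc k dvd int t * b" using nd cong_dvd_iff by blast
  then have t0: "t \<noteq> 0" by (metis dvd_0_right mult_zero_left of_nat_0)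
  have "[a * int t = a * (int p * b)] (mod int p ^ M)" "[int s * b = int p * a * b] (mod int p ^ M)"
    using s(2) t(2) by (auto intro: cong_scalar_left cong_scalar_right)
  then have "[a * int t - int s * b = a * (int p * b) - int p * a * b] (mod int p ^ M)"
    by (rule cong_diff)
  then have "int p ^ M dvd a * int t - int s * b" by (simp add: cong_iff_dvd_diff algebra_simps)
  then have "int p ^ N dvd a * int t - int s * b"
    by (rule dvd_trans[rotated]) (simp add: M_def le_imp_power_dvd)
  then have "padic_abs p (of_int (a * int t - int s * b) / of_int (int t * b)) < e"
    by (intro N) (use ntb t0 ab(2) in auto)
  also have "of_int (a * int t - int s * b) / of_int (int t * b) = r - of_nat s / of_nat t"
    using t0 ab by (simp add: field_simps)
  finally have "padic_dist p r (of_nat s / of_nat t) < e" by (simp add: padic_dist_def)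
  then show "\<exists>a\<in>ratio_set (sums_fourth_powers m). padic_dist p r a < e"
    using s(1) t(1) t0 unfolding ratio_set_def by blast
qed

section \<open>Density implies isotropy\<close>

text \<open>Descent: if \<open>p\<close> divides \<open>s\<close>, anisotropy makes \<open>p\<close>
  divide every \<open>x i\<close>, so \<open>s\<close> is \<open>p ^ 4\<close> times a smaller sum
  of \<open>m\<close> fourth powers.\<close>

lemma multiplicity_anisotropic:
  assumes p: "prime p" and "\<not> isotropic p m" and "s \<in> sums_fourth_powers m" "s \<noteq> 0"
  shows "4 dvd multiplicity (int p) (int s)"
  using assms(3,4)
proof (induction s rule: less_induct)
  case (less s)
  show ?case
  proof (cases "p dvd s")
    case True
    obtain x where x: "s = (\<Sum>i = 1..m. x i ^ 4)"
      using less.prems unfolding sums_fourth_powers_def by blast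
    then have "\<forall>i\<in>{1..m}. p dvd x i" using True assms(2) unfolding isotropic_def by blast
    then have "s = (\<Sum>i = 1..m. (p * (x i div p)) ^ 4)" unfolding x by (intro sum.cong) auto
    then have s: "s = p ^ 4 * (\<Sum>i = 1..m. (x i div p) ^ 4)"
      by (simp add: power_mult_distrib sum_distrib_left)
    define s' where "s' = (\<Sum>i = 1..m. (x i div p) ^ 4)"
    have s'0: "s' \<noteq> 0" using s less.prems s'_def by auto
    have "1 < p ^ 4" using prime_gt_1_nat[OF p] by (intro one_less_power) auto
    then have "s' < s" using s s'0 unfolding s'_def[symmetric] by simp
    moreover have "s' \<in> sums_fourth_powers m"
      unfolding sums_fourth_powers_def s'_def mem_Collect_eq
      by (rule exI[of _ "\<lambda>i. x i div p"]) (rule refl)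
    ultimately have "4 dvd multiplicity (int p) (int s')" using less.IH s'0 by simp
    moreover have "multiplicity (int p) (int s) = 4 + multiplicity (int p) (int s')"
      unfolding s s'_def[symmetric] of_nat_mult of_nat_power using p s'0 prime_gt_1_nat[OF p]
      by (subst prime_elem_multiplicity_mult_distrib) auto
    ultimately show ?thesis by simp
  qed (simp add: not_dvd_imp_multiplicity_0)
qed

text \<open>A rational closer to \<open>p\<close> than \<open>1 / p\<close> has valuation 1, whereas
  in the anisotropic case nonzero ratios have valuation divisible by 4.\<close>

lemma isotropic_if_dense:
  assumes p: "prime p" and dense: "dense_in_Qp p (ratio_set (sums_fourth_powers m))"
  shows "isotropic p m"
proof (rule ccontr)
  assume ni: "\<not> isotropic p m"
  have p1: "1 < real p" and p0: "p \<noteq> 0" and nu: "\<not> is_unit (int p)"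
    using prime_gt_1_nat[OF p] by auto
  have "0 < 1 / real p" using p1 by simp
  then obtain a where "a \<in> ratio_set (sums_fourth_powers m)" "padic_dist p (of_nat p) a < 1 / real p"
    using dense unfolding dense_in_Qp_iff[OF p] by blast
  then obtain s t where s: "s \<in> sums_fourth_powers m" and t: "t \<in> sums_fourth_powers m" "t \<noteq> 0"
    and d: "padic_dist p (of_nat p) (of_nat s / of_nat t) < 1 / real p"
    unfolding ratio_set_def by blast
  define x :: rat where "x = of_nat s / of_nat t"
  define y :: rat where "y = of_nat p - x"
  have vp: "padic_val p (of_nat p) = 1"
    using padic_val_fract[OF p, of "int p" 1] p0 nu by (simp add: multiplicity_self)
  have vy: "padic_val p y \<ge> 2" if "y \<noteq> 0"
  proof -
    have "real p powi (- padic_val p y) < real p powi (-1)"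
      using d that by (simp add: padic_dist_def padic_abs_def x_def y_def power_int_minus divide_inverse)
    then have "- padic_val p y < -1" using p1 
      by (meson not_le power_int_increasing less_imp_le)
    then show ?thesis by simp
  qed
  have x0: "x \<noteq> 0"
    using vy vp p0 by (auto simp: y_def)
  have vx: "padic_val p x = 1"
  proof (cases "y = 0")
    case False
    \<comment> \<open>Since \<open>y\<close> has valuation at least 2, the ultrametric inequality
      for the first sum gives valuation at most 1 for \<open>x\<close>, and for the second at least
      1.\<close>
    have xy: "x + y = of_nat p" "of_nat p + (- y) = x" by (simp_all add: y_def)
    have "padic_val p (x + y) \<ge> min (padic_val p x) (padic_val p y)"
      by (rule padic_val_add[OF p x0 False]) (simp add: xy(1) p0)
    moreover have "padic_val p (of_nat p + (- y)) \<ge> min (padic_val p (of_nat p)) (padic_val p (- y))"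
      by (rule padic_val_add[OF p]) (use x0 p0 False in \<open>simp_all only: xy(2), simp_all\<close>)
    ultimately show ?thesis
      using vy[OF False] vp padic_val_minus[OF p False] unfolding xy by linarith
  qed (use vp in \<open>simp add: y_def\<close>)
  have s0: "s \<noteq> 0" using x0 by (auto simp: x_def)
  have "padic_val p x = int (multiplicity (int p) (int s)) - int (multiplicity (int p) (int t))"
    using padic_val_fract[OF p, of "int s" "int t"] s0 t(2) by (simp add: x_def)
  moreover have "4 dvd multiplicity (int p) (int s)" "4 dvd multiplicity (int p) (int t)"
    using multiplicity_anisotropic[OF p ni] s s0 t by auto
  ultimately show False using vx by presburger
qed

section \<open>Cyclotomic numbers of order four\<close>

lemma sum_lessThan_4: "(\<Sum>k<4. F k) = F 0 + F 1 + F 2 + F (3::nat)"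
  by (simp add: lessThan_Suc eval_nat_numeral algebra_simps)

lemma fermat_theorem_int:
  assumes "prime p" and x: "\<not> int p dvd x"
  shows "[x ^ (p - 1) = 1] (mod int p)"
proof -
  define y where "y = nat (x mod int p)"
  have y: "int y = x mod int p" using prime_gt_0_nat[OF assms(1)] by (simp add: y_def)
  then have "\<not> p dvd y" using x by (metis dvd_mod_iff dvd_refl int_dvd_int_iff)
  then have "[y ^ (p - 1) = 1] (mod p)" using fermat_theorem assms(1) by blast
  then have "[int y ^ (p - 1) = 1] (mod int p)" by (metis cong_int_iff of_nat_1 of_nat_power)
  then show ?thesis unfolding y by (simp add: cong_def power_mod)
qed

text \<open>By \<open>g_half\<close>, \<open>g ^ f\<close> is a square root of -1, so its powers are
  the four fourth roots of unity modulo \<open>p\<close>. Oddness of \<open>f\<close> makes -1 a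
  square that is not a fourth power.\<close>

locale quartic_classes =
  fixes p f :: nat and g :: int
  assumes prime_p: "prime p" and p_eq: "p = 4 * f + 1" and odd_f: "odd f"
    and g_half: "[g ^ (2 * f) = - 1] (mod int p)"
begin

text \<open>\<open>h k\<close> is the indicator function of the class of \<open>g\<^sup>k\<close> modulo fourth powers; \<open>t i j k\<close> is the number
  of pairs \<open>x, y\<close> of classes \<open>i, j\<close> with \<open>x + y + g\<^sup>k = 0\<close>. As \<open>f * t i j k\<close> counts the zeros of \<open>x + y + z\<close> of
  classes \<open>i, j, k\<close>, it is symmetric.\<close>

definition h :: "nat \<Rightarrow> int \<Rightarrow> int" where
  "h k x = of_bool ([x ^ f = g ^ (f * k)] (mod int p))"

definition S :: "(int \<Rightarrow> int) \<Rightarrow> int" where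
  "S F = (\<Sum>x\<in>{0..<int p}. F x)"

text \<open>A convolution taken at \<open>- n\<close>, so that \<open>x\<close>, \<open>y\<close>
  and \<open>n\<close> enter the equation \<open>x + y + n = 0\<close> alike.\<close>

definition r :: "nat \<Rightarrow> nat \<Rightarrow> int \<Rightarrow> int" where
  "r i j n = S (\<lambda>x. h i x * h j (- n - x))"

definition t :: "nat \<Rightarrow> nat \<Rightarrow> nat \<Rightarrow> int" where
  "t i j k = r i j (g ^ k)"

section \<open>Classes of units modulo fourth powers\<close>

lemma p_gt_1: "int p > 1" and f_pos: "f > 0"
  using prime_gt_1_nat[OF prime_p] odd_f by (auto intro: odd_pos)

lemma prime_int_p: "prime (int p)"
  using prime_p by simp

lemma p_not_dvd_2: "\<not> int p dvd 2"
  using p_eq f_pos zdvd_imp_le[of "int p" 2] by auto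

lemma g_unit: "coprime g (int p)"
proof -
  have "coprime (-1) (int p)" by simp
  then have "coprime (g ^ (2 * f)) (int p)" using coprime_cong_cong_left[OF g_half] by blast
  then show ?thesis using f_pos by simp
qed

lemma g_period: "[g ^ (4 * f) = 1] (mod int p)"
  using cong_pow[OF g_half, of 2] by (simp add: power_mult[symmetric] mult.commute)

lemma h_cong:
  assumes "[x = y] (mod int p)"
  shows "h k x = h k y"
proof -
  have "[x ^ f = y ^ f] (mod int p)" using assms by (rule cong_pow)
  then have "[x ^ f = g ^ (f * k)] (mod int p) \<longleftrightarrow> [y ^ f = g ^ (f * k)] (mod int p)"
    by (blast intro: cong_sym cong_trans)
  then show ?thesis by (simp only: h_def)
qed

lemma h_period: "h (k + 4) x = h k x"
proof -
  have "[g ^ (f * k) * g ^ (4 * f) = g ^ (f * k) * 1] (mod int p)"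
    using g_period by (rule cong_scalar_left)
  then have "[g ^ (f * (k + 4)) = g ^ (f * k)] (mod int p)"
    by (simp add: power_add[symmetric] algebra_simps)
  then have "[x ^ f = g ^ (f * (k + 4))] (mod int p) \<longleftrightarrow> [x ^ f = g ^ (f * k)] (mod int p)"
    by (blast intro: cong_sym cong_trans)
  then show ?thesis by (simp only: h_def)
qed

lemma h_shift: "h (Suc k) (g * x) = h k x"
proof -
  have "coprime (g ^ f) (int p)" using g_unit by simp
  then have "[g ^ f * x ^ f = g ^ f * g ^ (f * k)] (mod int p) \<longleftrightarrow> [x ^ f = g ^ (f * k)] (mod int p)"
    by (rule cong_mult_lcancel)
  then show ?thesis unfolding h_def by (simp add: power_mult_distrib power_add)
qed

text \<open>As \<open>f\<close> is odd, \<open>(- 1) ^ f\<close> is -1, which is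
  \<open>g ^ (2 * f)\<close>: negation moves a class by two.\<close>

lemma h_neg: "h (k + 2) (- x) = h k x"
proof -
  have "[g ^ (f * k) * g ^ (2 * f) = g ^ (f * k) * (-1)] (mod int p)"
    using g_half by (rule cong_scalar_left)
  then have "[g ^ (f * (k + 2)) = - (g ^ (f * k))] (mod int p)"
    by (simp only: power_add[symmetric] distrib_left mult.commute[of 2] mult_minus_right mult_1_right)
  then have "[(- x) ^ f = g ^ (f * (k + 2))] (mod int p) \<longleftrightarrow> [- (x ^ f) = - (g ^ (f * k))] (mod int p)"
    unfolding power_minus_odd[OF odd_f] by (blast intro: cong_sym cong_trans)
  then show ?thesis unfolding h_def by (simp only: cong_minus_minus_iff)
qed

lemma h_g_power: "h k (g ^ k) = 1"
  unfolding h_def by (simp add: power_mult[symmetric] mult.commute)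

lemma h_zero: "int p dvd x \<Longrightarrow> h k x = 0"
proof -
  assume "int p dvd x"
  then have "[x = 0] (mod int p)" by (simp add: cong_0_iff)
  then have "[x ^ f = 0 ^ f] (mod int p)" by (rule cong_pow)
  then have x: "[x ^ f = 0] (mod int p)" using f_pos by (simp add: zero_power)
  have "\<not> [0 = g ^ (f * k)] (mod int p)"
  proof
    assume "[0 = g ^ (f * k)] (mod int p)"
    then have "int p dvd g ^ (f * k)" by (metis cong_0_iff cong_sym)
    then have "int p dvd g" using prime_int_p by (metis prime_dvd_power)
    then show False using g_unit p_gt_1 by (metis coprime_common_divisor dvd_refl zdvd1_eq abs_of_nat less_irrefl)
  qed
  then have "\<not> [x ^ f = g ^ (f * k)] (mod int p)" using x cong_sym cong_trans by blast
  then show ?thesis by (simp add: h_def)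
qed

text \<open>By Fermat, \<open>x ^ f\<close> is a root of \<open>Z ^ 4 - 1\<close>. With
  \<open>w = g ^ f\<close> these roots are 1, \<open>w\<close>, -1 and \<open>- w\<close>, and they
  are distinct modulo \<open>p\<close>.\<close>

lemma h_partition:
  assumes "\<not> int p dvd x"
  shows "h 0 x + h 1 x + h 2 x + h 3 x = 1"
proof -
  let ?P = "int p"
  define w where "w = g ^ f"
  define z where "z = x ^ f"
  have hk: "h k x = of_bool (?P dvd z - w ^ k)" for k
    unfolding h_def w_def z_def by (simp add: cong_iff_dvd_diff power_mult)
  have w2: "?P dvd w ^ 2 + 1"
    using g_half by (simp add: cong_iff_dvd_diff w_def power_mult[symmetric] mult.commute)
  have "?P dvd z ^ 4 - 1"
    using fermat_theorem_int[OF prime_p assms] p_eq by (simp add: cong_iff_dvd_diff z_def power_mult[symmetric] mult.commute)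
  moreover have "z ^ 4 - 1 = (z - 1) * (z + 1) * ((z - w) * (z + w)) + (z - 1) * (z + 1) * (w ^ 2 + 1)"
    by (simp add: power4_eq_xxxx power2_eq_square algebra_simps)
  ultimately have "?P dvd (z - 1) * (z + 1) * ((z - w) * (z + w))"
    using w2 by (metis dvd_add_left_iff dvd_mult)
  then have cases: "?P dvd z - 1 \<or> ?P dvd z + 1 \<or> ?P dvd z - w \<or> ?P dvd z + w"
    using prime_int_p by (simp add: prime_dvd_mult_iff)
  have h0: "?P dvd z - w ^ 0 \<longleftrightarrow> ?P dvd z - 1" and h1: "?P dvd z - w ^ 1 \<longleftrightarrow> ?P dvd z - w" by simp_all
  have "z - w ^ 2 = (z + 1) - (w ^ 2 + 1)" by simp
  then have h2: "?P dvd z - w ^ 2 \<longleftrightarrow> ?P dvd z + 1"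
    using w2 by (metis dvd_diff_right_iff dvd_diff_left_iff)
  have "z - w ^ 3 = (z + w) - w * (w ^ 2 + 1)"
    by (simp add: power3_eq_cube power2_eq_square algebra_simps)
  then have h3: "?P dvd z - w ^ 3 \<longleftrightarrow> ?P dvd z + w"
    using w2 by (metis dvd_diff_left_iff dvd_mult)
  \<comment> \<open>Up to sign, the differences of the four roots are 2, \<open>2 * w\<close>,
    \<open>w - 1\<close> and \<open>w + 1\<close>; each is prime to \<open>p\<close>, since
    \<open>p\<close> is odd and divides \<open>w ^ 2 + 1\<close>.\<close>
  have w1: "\<not> ?P dvd w - 1"
  proof
    assume "?P dvd w - 1"
    moreover have "2 = (w ^ 2 + 1) - (w + 1) * (w - 1)" by (simp add: power2_eq_square algebra_simps)
    ultimately show False using w2 p_not_dvd_2 by (metis dvd_diff dvd_mult)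
  qed
  have w3: "\<not> ?P dvd w + 1"
  proof
    assume "?P dvd w + 1"
    moreover have "2 = (w ^ 2 + 1) - (w - 1) * (w + 1)" by (simp add: power2_eq_square algebra_simps)
    ultimately show False using w2 p_not_dvd_2 by (metis dvd_diff dvd_mult)
  qed
  have ww: "\<not> ?P dvd 2 * w"
  proof
    assume "?P dvd 2 * w"
    then have "?P dvd w" using prime_int_p p_not_dvd_2 by (simp add: prime_dvd_mult_iff)
    then have "?P dvd w * w" by simp
    then have "?P dvd 1" using w2 by (simp add: power2_eq_square dvd_add_right_iff)
    then show False using p_gt_1 by simp
  qed
  have n01: "\<not> (?P dvd z - 1 \<and> ?P dvd z - w)" using w1 dvd_diff[of ?P "z - 1" "z - w"] by auto
  have n02: "\<not> (?P dvd z - 1 \<and> ?P dvd z + 1)" using p_not_dvd_2 dvd_diff[of ?P "z + 1" "z - 1"] by auto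
  have n03: "\<not> (?P dvd z - 1 \<and> ?P dvd z + w)"
    using w3 dvd_diff[of ?P "z + w" "z - 1"] by (auto simp: algebra_simps)
  have n12: "\<not> (?P dvd z - w \<and> ?P dvd z + 1)"
    using w3 dvd_diff[of ?P "z + 1" "z - w"] by (auto simp: algebra_simps)
  have n13: "\<not> (?P dvd z - w \<and> ?P dvd z + w)" using ww dvd_diff[of ?P "z + w" "z - w"] by auto
  have n23: "\<not> (?P dvd z + 1 \<and> ?P dvd z + w)" using w1 dvd_diff[of ?P "z + w" "z + 1"] by auto
  show ?thesis unfolding hk h0 h1 h2 h3 using cases n01 n02 n03 n12 n13 n23 by auto
qed

section \<open>Sums over the residues modulo p\<close>

lemma S_affine:
  assumes a: "coprime a (int p)" and F: "\<And>x. F (x mod int p) = F x"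
  shows "S (\<lambda>x. F (a * x + b)) = S F"
proof -
  let ?u = "\<lambda>x. (a * x + b) mod int p"
  have inj: "inj_on ?u {0..<int p}"
  proof (rule inj_onI)
    fix x y assume xy: "x \<in> {0..<int p}" "y \<in> {0..<int p}" "?u x = ?u y"
    then have "[a * x + b = a * y + b] (mod int p)" by (simp add: cong_def)
    then have "[a * x = a * y] (mod int p)" by (simp add: cong_add_rcancel)
    then have "[x = y] (mod int p)" using a by (simp add: cong_mult_lcancel)
    then show "x = y" using xy by (simp add: cong_def)
  qed
  have "?u ` {0..<int p} = {0..<int p}"
    using p_gt_1 by (intro endo_inj_surj inj) auto
  with inj have "bij_betw ?u {0..<int p} {0..<int p}" by (simp add: bij_betw_def)
  from sum.reindex_bij_betw[OF this, of F] show ?thesis unfolding S_def by (simp add: F)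
qed

lemma S_reflect:
  assumes F: "\<And>x. F (x mod int p) = F x"
  shows "S (\<lambda>x. F (- b - x)) = S F"
proof -
  have "(\<lambda>x. F (- b - x)) = (\<lambda>x. F ((- 1) * x + (- b)))" by (simp add: minus_diff_commute)
  then show ?thesis using S_affine[of "-1" F "- b", OF _ F] by simp
qed

lemma S_scale:
  assumes "coprime a (int p)" and F: "\<And>x. F (x mod int p) = F x"
  shows "S (\<lambda>x. F (a * x)) = S F"
  using S_affine[of a F 0, OF assms(1) F] by simp

lemma S_swap: "S (\<lambda>x. S (\<lambda>y. G x y)) = S (\<lambda>y. S (\<lambda>x. G x y))"
  unfolding S_def by (rule sum.swap)

lemma S_mult_left: "S (\<lambda>x. c * F x) = c * S F"
  and S_mult_right: "S (\<lambda>x. F x * c) = S F * c"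
  and S_add: "S (\<lambda>x. F x + G x) = S F + S G"
  unfolding S_def by (simp_all add: sum_distrib_left sum_distrib_right sum.distrib)

lemma h_mod: "h k (x mod int p) = h k x"
  by (rule h_cong) simp

lemma h_mod_diff: "h k (c - x mod int p) = h k (c - x)"
  by (rule h_cong) (simp add: cong_def mod_diff_right_eq)

lemma r_cong: "[m = n] (mod int p) \<Longrightarrow> r i j m = r i j n"
proof -
  assume "[m = n] (mod int p)"
  then have "h j (- m - x) = h j (- n - x)" for x
    by (intro h_cong cong_diff) (auto simp: cong_minus_minus_iff)
  then show ?thesis by (simp add: r_def)
qed

lemma r_mod: "r i j (x mod int p) = r i j x"
  by (rule r_cong) simp

lemma r_commute: "r i j n = r j i n"
proof -
  have "r i j n = S (\<lambda>x. h i (- n - x) * h j (- n - (- n - x)))"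
    unfolding r_def
    by (rule S_reflect[where F = "\<lambda>x. h i x * h j (- n - x)" and b = n, symmetric]) (simp add: h_mod h_mod_diff)
  then show ?thesis by (simp add: r_def mult.commute)
qed

text \<open>The residues consist of 0 and the four classes; this turns a total into values per
  class.\<close>

lemma S_split:
  assumes F: "\<And>x. F (x mod int p) = F x"
  shows "S F = F 0 + (\<Sum>k<4. S (\<lambda>x. h k x * F x))"
proof -
  have "(\<Sum>k<4. S (\<lambda>x. h k x * F x)) = S (\<lambda>x. (h 0 x + h 1 x + h 2 x + h 3 x) * F x)"
    by (simp add: sum_lessThan_4 distrib_right S_add)
  also have "\<dots> = S (\<lambda>x. if x = 0 then 0 else F x)"
    unfolding S_def
  proof (rule sum.cong)
    fix x assume "x \<in> {0..<int p}"
    then have "x \<noteq> 0 \<Longrightarrow> \<not> int p dvd x" using zdvd_imp_le[of "int p" x] by auto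
    then show "(h 0 x + h 1 x + h 2 x + h 3 x) * F x = (if x = 0 then 0 else F x)"
      using h_partition[of x] h_zero[of x] by auto
  qed simp
  also have "F 0 + \<dots> = S F"
    unfolding S_def using p_gt_1 by (subst (1 2) sum.remove[of _ 0]) auto
  finally show ?thesis by simp
qed

text \<open>Multiplication by \<open>g\<close> maps each class onto the next, so the four classes
  share the \<open>4 * f\<close> units equally.\<close>

lemma S_h: "S (h k) = int f"
proof -
  have step: "S (h (Suc k)) = S (h k)" for k
    using S_scale[OF g_unit, of "h (Suc k)"] by (simp add: h_shift h_mod)
  have all: "S (h k) = S (h 0)" for k by (induction k) (auto simp: step)
  have "S (\<lambda>x. 1) = 1 + (\<Sum>k<4. S (\<lambda>x. h k x * 1))" by (rule S_split) simp
  also have "\<dots> = 1 + 4 * S (h 0)" using all[of 1] all[of 2] all[of 3] by (simp add: sum_lessThan_4)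
  finally have "int p = 1 + 4 * S (h 0)" by (simp add: S_def)
  then show ?thesis using all[of k] p_eq by linarith
qed

lemma h_classD:
  assumes "h k m = 1" "h k n = 1"
  obtains c where "h 0 c = 1" "coprime c (int p)" "[c * n = m] (mod int p)"
proof -
  have m: "\<not> int p dvd m" and n: "\<not> int p dvd n" using assms h_zero[of m k] h_zero[of n k] by auto
  then have "coprime n (int p)" and cm: "coprime m (int p)"
    using prime_int_p prime_imp_coprime coprime_commute by blast+
  then obtain u where u: "[n * u = 1] (mod int p)" using cong_solve_coprime_int by blast
  define c where "c = m * u"
  have "[m * (n * u) = m * 1] (mod int p)" using u by (rule cong_scalar_left)
  then have cn: "[c * n = m] (mod int p)" by (simp add: c_def ac_simps)
  then have "coprime (c * n) (int p)" using cm coprime_cong_cong_left by blast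
  then have cc: "coprime c (int p)" by simp
  have "[c ^ f * n ^ f = m ^ f] (mod int p)" using cong_pow[OF cn, of f] by (simp add: power_mult_distrib)
  moreover have "[m ^ f = n ^ f] (mod int p)"
    using assms unfolding h_def of_bool_eq_1_iff by (blast intro: cong_sym cong_trans)
  ultimately have "[n ^ f * c ^ f = n ^ f * 1] (mod int p)"
    unfolding mult.commute[of "n ^ f"] mult_1 by (rule cong_trans)
  moreover have "coprime (n ^ f) (int p)" using \<open>coprime n (int p)\<close> by simp
  ultimately have "[c ^ f = 1] (mod int p)" using cong_mult_lcancel by blast
  then show ?thesis using that cc cn by (simp add: h_def)
qed

section \<open>Counts by classes and their symmetries\<close>

text \<open>The quotient \<open>c\<close> of \<open>m\<close> by \<open>n\<close> has class 0, so
  scaling by \<open>c\<close> preserves all classes and carries the solutions for \<open>n\<close>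
  to those for \<open>m\<close>. Hence \<open>t\<close> records all values of \<open>r\<close> at
  units.\<close>

lemma r_class:
  assumes "h k m = 1" "h k n = 1"
  shows "r i j m = r i j n"
proof -
  obtain c where c: "h 0 c = 1" "coprime c (int p)" "[c * n = m] (mod int p)"
    using h_classD[OF assms] by blast
  have hc: "h l (c * x) = h l x" for l x
  proof -
    have "[c ^ f * x ^ f = 1 * x ^ f] (mod int p)"
      using c(1) unfolding h_def by (intro cong_scalar_right) simp
    then have "[(c * x) ^ f = x ^ f] (mod int p)" by (simp add: power_mult_distrib)
    then have "[(c * x) ^ f = g ^ (f * l)] (mod int p) \<longleftrightarrow> [x ^ f = g ^ (f * l)] (mod int p)"
      by (blast intro: cong_sym cong_trans)
    then show ?thesis by (simp only: h_def)
  qed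
  have "r i j m = r i j (c * n)" by (rule r_cong[OF cong_sym[OF c(3)]])
  also have "\<dots> = S (\<lambda>x. h i (c * x) * h j (- (c * n) - c * x))"
    unfolding r_def
    by (rule S_scale[where F = "\<lambda>x. h i x * h j (- (c * n) - x)", OF c(2), symmetric]) (simp add: h_mod h_mod_diff)
  also have "\<dots> = S (\<lambda>x. h i (c * x) * h j (c * (- n - x)))"
    by (simp add: algebra_simps)
  also have "\<dots> = r i j n" by (simp add: hc r_def)
  finally show ?thesis .
qed

lemma h_cases: "h k x = 0 \<or> h k x = 1"
  by (simp add: h_def)

lemma f_times_t: "S (\<lambda>n. h k n * r i j n) = int f * t i j k"
proof -
  have "h k n * r i j n = h k n * t i j k" for n
    using h_cases[of k n] r_class[of k n "g ^ k" i j] h_g_power by (auto simp: t_def)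
  then have "S (\<lambda>n. h k n * r i j n) = S (\<lambda>n. h k n * t i j k)" by (simp only:)
  then show ?thesis by (simp add: S_mult_right S_h)
qed

lemma t_eqI:
  "S (\<lambda>n. h k n * r i j n) = S (\<lambda>n. h k' n * r i' j' n) \<Longrightarrow> t i j k = t i' j' k'"
  using f_pos by (simp add: f_times_t)

lemma t_commute: "t i j k = t j i k"
  by (simp add: t_def r_commute)

text \<open>For fixed \<open>x\<close>, the substitution of \<open>- x - n\<close> for
  \<open>n\<close> exchanges the other two summands. Together with \<open>t_commute\<close> this
  yields every permutation of the indices.\<close>

lemma t_rotate: "t i j k = t i k j"
proof (rule t_eqI)
  have "S (\<lambda>n. h k n * r i j n) = S (\<lambda>n. S (\<lambda>x. h k n * (h i x * h j (- n - x))))"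
    by (simp add: r_def S_mult_left)
  also have "\<dots> = S (\<lambda>x. S (\<lambda>n. h k n * (h i x * h j (- n - x))))" by (rule S_swap)
  also have "\<dots> = S (\<lambda>x. S (\<lambda>n. h k (- x - n) * (h i x * h j (- (- x - n) - x))))"
  proof -
    have "S (\<lambda>n. h k n * (h i x * h j (- n - x)))
        = S (\<lambda>n. h k (- x - n) * (h i x * h j (- (- x - n) - x)))" for x
      by (rule S_reflect[where F = "\<lambda>n. h k n * (h i x * h j (- n - x))" and b = x, symmetric])
        (simp add: h_mod h_mod_diff minus_diff_commute)
    then show ?thesis by (simp only:)
  qed
  also have "\<dots> = S (\<lambda>n. S (\<lambda>x. h j n * (h i x * h k (- n - x))))"
  proof -
    have "- (- x - n) - x = n" "- x - n = - n - x" for x n :: int by simp_all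
    then have "h k (- x - n) * (h i x * h j (- (- x - n) - x)) = h j n * (h i x * h k (- n - x))" for x n
      by (metis mult.commute mult.left_commute)
    then show ?thesis by (subst S_swap) (simp only:)
  qed
  also have "\<dots> = S (\<lambda>n. h j n * r i k n)" by (simp add: r_def S_mult_left)
  finally show "S (\<lambda>n. h k n * r i j n) = S (\<lambda>n. h j n * r i k n)" .
qed

text \<open>Multiplying \<open>x + y + z = 0\<close> by \<open>g\<close> raises all three classes by
  one.\<close>

lemma t_shift: "t (Suc i) (Suc j) (Suc k) = t i j k"
proof (rule t_eqI)
  have r: "r (Suc i) (Suc j) (g * n) = r i j n" for n
  proof -
    have "r (Suc i) (Suc j) (g * n) = S (\<lambda>x. h (Suc i) (g * x) * h (Suc j) (- (g * n) - g * x))"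
      unfolding r_def
      by (rule S_scale[where F = "\<lambda>x. h (Suc i) x * h (Suc j) (- (g * n) - x)", OF g_unit, symmetric])
        (simp add: h_mod h_mod_diff)
    also have "\<dots> = S (\<lambda>x. h (Suc i) (g * x) * h (Suc j) (g * (- n - x)))"
      by (simp add: algebra_simps)
    also have "\<dots> = r i j n" by (simp add: h_shift r_def)
    finally show ?thesis .
  qed
  have "S (\<lambda>n. h (Suc k) n * r (Suc i) (Suc j) n) = S (\<lambda>n. h (Suc k) (g * n) * r (Suc i) (Suc j) (g * n))"
    by (rule S_scale[where F = "\<lambda>n. h (Suc k) n * r (Suc i) (Suc j) n", OF g_unit, symmetric])
      (simp add: h_mod r_mod)
  then show "S (\<lambda>n. h (Suc k) n * r (Suc i) (Suc j) n) = S (\<lambda>n. h k n * r i j n)"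
    by (simp add: h_shift r)
qed

lemma t_period: "t (i + 4) j k = t i j k" "t i (j + 4) k = t i j k" "t i j (k + 4) = t i j k"
proof -
  show 1: "t (i + 4) j k = t i j k" for i j k by (simp only: t_def r_def h_period)
  show 2: "t i (j + 4) k = t i j k" for i j k by (simp only: t_def r_def h_period)
  show "t i j (k + 4) = t i j k" by (metis 2 t_rotate)
qed

lemma r_zero: "r i j 0 = S (\<lambda>x. h i x * h (j + 2) x)"
proof -
  have "h j (- x) = h (j + 2) x" for x
    using h_neg[of j "- x"] by simp
  then show ?thesis by (simp add: r_def)
qed

lemma h_disjoint:
  assumes "i < 4" "j < 4" "i \<noteq> j"
  shows "h i x * h j x = 0"
proof (cases "int p dvd x")
  case False
  have "i \<in> {0,1,2,3}" "j \<in> {0,1,2,3}" using assms by auto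
  then show ?thesis
    using h_partition[OF False] assms(3) h_cases[of 0 x] h_cases[of 1 x] h_cases[of 2 x] h_cases[of 3 x]
    by auto
qed (simp add: h_zero)

lemma r_zero_diag: "r 0 2 0 = int f"
proof -
  have "h 0 x * h (2 + 2) x = h 0 x" for x
    using h_period[of 0 x] h_cases[of 0 x] by auto
  then show ?thesis unfolding r_zero by (simp only: S_h)
qed

lemma r_zero_off: "r 0 0 0 = 0" "r 0 1 0 = 0"
proof -
  have "h 0 x * h (0 + 2) x = 0" "h 0 x * h (1 + 2) x = 0" for x
    by (rule h_disjoint; simp)+
  then show "r 0 0 0 = 0" "r 0 1 0 = 0" unfolding r_zero by (simp_all only: S_def sum.neutral_const)
qed

section \<open>Linear and quadratic relations\<close>

text \<open>The \<open>f ^ 2\<close> pairs of classes \<open>i\<close> and \<open>j\<close> are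
  sorted by the class of the negative of their sum; \<open>r i j 0\<close> counts those with sum
  0.\<close>

lemma t_row: "int f * (\<Sum>k<4. t i j k) = int f ^ 2 - r i j 0"
proof -
  have "S (r i j) = S (\<lambda>n. S (\<lambda>x. h i x * h j (- n - x)))"
    by (rule arg_cong[where f = S]) (rule ext, rule r_def)
  also have "\<dots> = S (\<lambda>x. S (\<lambda>n. h i x * h j (- n - x)))" by (rule S_swap)
  also have "\<dots> = S (\<lambda>x. h i x * S (\<lambda>n. h j (- x - n)))" by (simp add: S_mult_left minus_diff_commute)
  also have "\<dots> = int f * int f"
    using S_reflect[of "h j"] by (simp add: h_mod S_h S_mult_right)
  finally have "int f ^ 2 = S (r i j)" by (simp add: power2_eq_square)
  also have "\<dots> = r i j 0 + (\<Sum>k<4. S (\<lambda>x. h k x * r i j x))"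
    by (rule S_split) (simp add: r_mod)
  finally show ?thesis by (simp add: f_times_t sum_distrib_left)
qed

text \<open>Both sides count the solutions of \<open>x + y + z + w = 0\<close> with \<open>x, y, z, w\<close> of classes \<open>i, j, k, l\<close>.\<close>

lemma energy_swap: "S (\<lambda>n. r i j n * r k l (- n)) = S (\<lambda>n. r i k n * r j l (- n))"
proof -
  have "S (\<lambda>n. r i j n * r k l (- n)) = S (\<lambda>x. S (\<lambda>n. S (\<lambda>y. h i x * h j n * h k y * h l (- x - n - y))))"
    for i j k l
  proof -
    have "S (\<lambda>n. r i j n * r k l (- n))
        = S (\<lambda>n. S (\<lambda>x. h i x * h j (- n - x) * S (\<lambda>y. h k y * h l (n - y))))"
      by (simp add: r_def S_mult_right)
    also have "\<dots> = S (\<lambda>x. S (\<lambda>n. h i x * h j (- n - x) * S (\<lambda>y. h k y * h l (n - y))))"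
      by (rule S_swap)
    also have "\<dots> = S (\<lambda>x. S (\<lambda>n. h i x * h j n * S (\<lambda>y. h k y * h l (- x - n - y))))"
    proof -
      have "S (\<lambda>n. h i x * h j (- n - x) * S (\<lambda>y. h k y * h l (n - y)))
          = S (\<lambda>n. h i x * h j n * S (\<lambda>y. h k y * h l (- x - n - y)))" for x
      proof -
        have "h l (- x - n mod int p - y) = h l (- x - n - y)" for n y
          by (intro h_cong cong_diff) auto
        then have "S (\<lambda>n. h i x * h j n * S (\<lambda>y. h k y * h l (- x - n - y)))
            = S (\<lambda>n. h i x * h j (- x - n) * S (\<lambda>y. h k y * h l (- x - (- x - n) - y)))"
          by (intro S_reflect[where F = "\<lambda>n. h i x * h j n * S (\<lambda>y. h k y * h l (- x - n - y))"
              and b = x, symmetric]) (simp add: h_mod)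
        then show ?thesis by (simp add: minus_diff_commute)
      qed
      then show ?thesis by (simp only:)
    qed
    also have "\<dots> = S (\<lambda>x. S (\<lambda>n. S (\<lambda>y. h i x * h j n * h k y * h l (- x - n - y))))"
      by (simp add: S_mult_left[symmetric] mult.assoc)
    finally show ?thesis .
  qed
  note expand = this
  have "h i x * h k n * h j y * h l (- x - n - y) = h i x * h j y * h k n * h l (- x - y - n)" for x n y
    by (simp add: algebra_simps)
  then have "S (\<lambda>n. r i k n * r j l (- n)) = S (\<lambda>x. S (\<lambda>n. S (\<lambda>y. h i x * h j y * h k n * h l (- x - y - n))))"
    by (simp only: expand)
  also have "\<dots> = S (\<lambda>n. r i j n * r k l (- n))"
    by (simp only: expand S_swap[of "\<lambda>n y. h i x * h j y * h k n * h l (- x - y - n)" for x])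
  finally show ?thesis ..
qed

text \<open>The sum is split by the class of \<open>n\<close>, on which \<open>r\<close> is
  constant. The shift \<open>c + 2\<close> is the class of \<open>- n\<close>.\<close>

lemma energy_eq:
  "S (\<lambda>n. r i j n * r k l (- n)) = r i j 0 * r k l 0 + int f * (\<Sum>c<4. t i j c * t k l (c + 2))"
proof -
  have "S (\<lambda>n. r i j n * r k l (- n)) = r i j 0 * r k l (- 0) + (\<Sum>c<4. S (\<lambda>n. h c n * (r i j n * r k l (- n))))"
  proof (rule S_split)
    fix x
    have "r k l (- (x mod int p)) = r k l (- x)" by (rule r_cong) (simp add: cong_def mod_minus_eq)
    then show "r i j (x mod int p) * r k l (- (x mod int p)) = r i j x * r k l (- x)" by (simp add: r_mod)
  qed
  moreover have "S (\<lambda>n. h c n * (r i j n * r k l (- n))) = int f * (t i j c * t k l (c + 2))" for c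
  proof -
    have "h c n * (r i j n * r k l (- n)) = h c n * (t i j c * t k l (c + 2))" for n
    proof (cases "h c n = 1")
      case True
      then have "h (c + 2) (- n) = 1" by (simp only: h_neg)
      then show ?thesis
        unfolding t_def using r_class[OF True h_g_power] r_class[OF _ h_g_power] by metis
    qed (use h_cases[of c n] in auto)
    then have "S (\<lambda>n. h c n * (r i j n * r k l (- n))) = S (\<lambda>n. h c n * (t i j c * t k l (c + 2)))"
      by (simp only:)
    then show ?thesis by (simp add: S_mult_right S_h)
  qed
  ultimately show ?thesis by (simp add: sum_distrib_left)
qed

text \<open>The linear relations are \<open>t_row\<close> for the class pairs (0,0), (0,1) and
  (0,2). The quadratic one equates, by \<open>energy_swap\<close>, the pairings of (0,0) with (2,2)
  and of (0,2) with (0,2).\<close>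

lemma t_relations:
  defines "A \<equiv> t 0 0 2" and "B \<equiv> t 0 0 3" and "C \<equiv> t 0 0 0" and "D \<equiv> t 0 0 1" and "E \<equiv> t 0 1 2"
  shows "A + B + C + D = int f" "B + D + 2 * E = int f" "2 * A + 2 * E = int f - 1"
    "A\<^sup>2 + B\<^sup>2 + C\<^sup>2 + D\<^sup>2 = int f + 2 * A\<^sup>2 + 2 * E\<^sup>2"
proof -
  have f0: "int f \<noteq> 0" using f_pos by simp
  have sh: "t (i + 1) (j + 1) (k + 1) = t i j k" for i j k using t_shift by simp
  have sh2: "t (i + 2) (j + 2) (k + 2) = t i j k" for i j k
    using t_shift[of i j k] t_shift[of "Suc i" "Suc j" "Suc k"] by simp
  \<comment> \<open>Permuting the indices, shifting them together and reducing modulo 4 brings each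
    entry of these rows to one of the five values.\<close>
  have e010: "t 0 1 0 = D" unfolding D_def by (rule t_rotate)
  have e011: "t 0 1 1 = B"
    using sh[of 3 0 0] t_period(1)[of 0 1 1] t_commute[of 3 0 0] t_rotate[of 0 3 0] unfolding B_def by simp
  have "t 0 1 3 = t 1 2 (0 + 4)" using sh[of 0 1 3] by (simp add: numeral_2_eq_2)
  also have "\<dots> = t 1 2 0" by (rule t_period)
  also have "\<dots> = t 1 0 2" by (rule t_rotate)
  also have "\<dots> = E" unfolding E_def by (rule t_commute)
  finally have e013: "t 0 1 3 = E" .
  have e020: "t 0 2 0 = A" unfolding A_def by (rule t_rotate)
  have e021: "t 0 2 1 = E" unfolding E_def by (rule t_rotate)
  have "t 0 2 2 = t 2 (0 + 4) (0 + 4)" using sh2[of 0 2 2] by (simp del: add_2_eq_Suc add_2_eq_Suc')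
  also have "\<dots> = t 2 0 0" by (simp only: t_period)
  finally have e022: "t 0 2 2 = A" using t_commute[of 2 0 0] e020 by simp
  have "t 0 2 3 = t 2 (0 + 4) (1 + 4)" using sh2[of 0 2 3] by (simp del: add_2_eq_Suc add_2_eq_Suc')
  also have "\<dots> = t 2 0 1" by (simp only: t_period)
  finally have e023: "t 0 2 3 = E" using t_commute[of 2 0 1] e021 by simp
  show r1: "A + B + C + D = int f"
    using t_row[of 0 0] f0 unfolding sum_lessThan_4 r_zero_off A_def B_def C_def D_def
    by (simp add: power2_eq_square)
  show "B + D + 2 * E = int f"
    using t_row[of 0 1] f0 unfolding sum_lessThan_4 r_zero_off e010 e011 e013 E_def
    by (simp add: power2_eq_square)
  have "int f * (2 * A + 2 * E) = int f * (int f - 1)"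
    using t_row[of 0 2] unfolding sum_lessThan_4 r_zero_diag e020 e021 e022 e023
    by (simp add: power2_eq_square algebra_simps)
  then show "2 * A + 2 * E = int f - 1" using f0 by simp
  have "int f * (A\<^sup>2 + B\<^sup>2 + C\<^sup>2 + D\<^sup>2) = S (\<lambda>n. r 0 0 n * r 2 2 (- n))"
    unfolding energy_eq r_zero_off sum_lessThan_4 using sh2[of 0 0 0] sh2[of 0 0 1] sh2[of 0 0 2] sh2[of 0 0 3]
    unfolding A_def B_def C_def D_def by (simp add: power2_eq_square eval_nat_numeral)
  also have "\<dots> = S (\<lambda>n. r 0 2 n * r 0 2 (- n))" by (rule energy_swap)
  also have "\<dots> = int f * (int f + 2 * A\<^sup>2 + 2 * E\<^sup>2)"
    unfolding energy_eq sum_lessThan_4 r_zero_diag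
    using t_period(3)[of 0 2 0] t_period(3)[of 0 2 1] e020 e021 e022 e023
    by (simp add: power2_eq_square algebra_simps del: One_nat_def add_2_eq_Suc add_2_eq_Suc')
  finally show "A\<^sup>2 + B\<^sup>2 + C\<^sup>2 + D\<^sup>2 = int f + 2 * A\<^sup>2 + 2 * E\<^sup>2" using f0 by simp
qed

lemma t_nonneg: "t i j k \<ge> 0"
  unfolding t_def r_def S_def h_def by (intro sum_nonneg) auto

section \<open>Three fourth powers with sum zero\<close>

lemma t_000_nonzero:
  assumes "p \<noteq> 5" "p \<noteq> 29"
  shows "t 0 0 0 \<noteq> 0"
proof
  assume C: "t 0 0 0 = 0"
  define A B D E where "A = t 0 0 2" "B = t 0 0 3" "D = t 0 0 1" "E = t 0 1 2"
  have rel: "A + B + D = int f" "B + D + 2 * E = int f" "2 * A + 2 * E = int f - 1"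
    "A\<^sup>2 + B\<^sup>2 + D\<^sup>2 = int f + 2 * A\<^sup>2 + 2 * E\<^sup>2"
    using t_relations C unfolding A_B_D_E_def by simp_all
  have f: "int f = 3 * A + 1" and E: "2 * E = A" and D: "D = 2 * A + 1 - B" using rel(1-3) by linarith+
  \<comment> \<open>Combine the quadratic relation with \<open>B + D = 2 * A + 1\<close>, using that
    \<open>(B - D)\<close> squared is twice the sum of the squares minus \<open>(B + D)\<close>
    squared.\<close>
  have "(B - D)\<^sup>2 = 2 - (A - 1)\<^sup>2"
  proof -
    have "2 * (2 * E\<^sup>2) = A\<^sup>2" using E by (auto simp: power2_eq_square)
    then show ?thesis using rel(4) f unfolding D
      by (simp add: power2_eq_square algebra_simps)
  qed
  then have "(A - 1)\<^sup>2 \<le> 2" using zero_le_power2[of "B - D"] by linarith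
  have "A \<le> 2"
  proof (rule ccontr)
    assume "\<not> A \<le> 2"
    then have "2 * 2 \<le> (A - 1) * (A - 1)" by (intro mult_mono) auto
    then show False using \<open>(A - 1)\<^sup>2 \<le> 2\<close> by (simp add: power2_eq_square)
  qed
  moreover have "A \<ge> 0" unfolding A_B_D_E_def by (rule t_nonneg)
  \<comment> \<open>\<open>A = 1\<close> would give the even value \<open>f = 4\<close>. The
    remaining values 0 and 2 give \<open>f = 1\<close> and \<open>f = 7\<close>, that is
    \<open>p = 5\<close> and \<open>p = 29\<close>.\<close>
  moreover have "A \<noteq> 1" using f odd_f by auto
  ultimately have "A = 0 \<or> A = 2" by linarith
  then show False using f p_eq assms by auto
qed

text \<open>As \<open>f\<close> is odd, some \<open>k * f + 1\<close> equals \<open>4 * q\<close>;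
  then \<open>x\<close> is congruent to \<open>x ^ (k * f + 1)\<close>, the fourth power of
  \<open>x ^ q\<close>.\<close>

lemma fourth_power_if_class_0:
  assumes "h 0 x = 1"
  shows "\<exists>a. [a ^ 4 = x] (mod int p)"
proof -
  have x: "[x ^ f = 1] (mod int p)" using assms by (simp add: h_def)
  obtain k where k: "4 dvd k * f + 1"
  proof (cases "f mod 4 = 3")
    case True
    then show ?thesis by (intro that[of 1]) presburger
  next
    case False
    then have "f mod 4 = 1" using odd_f by presburger
    then show ?thesis by (intro that[of 3]) presburger
  qed
  then obtain q where q: "k * f + 1 = 4 * q" by blast
  have "[(x ^ f) ^ k * x = 1 ^ k * x] (mod int p)" using x by (intro cong_scalar_right cong_pow)
  moreover have "(x ^ f) ^ k * x = x ^ (k * f + 1)" by (simp add: power_mult[symmetric] mult.commute)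
  also have "\<dots> = (x ^ q) ^ 4" unfolding q by (simp add: power_mult[symmetric] mult.commute)
  ultimately show ?thesis by auto
qed

lemma three_fourth_powers:
  assumes "p \<noteq> 5" "p \<noteq> 29"
  shows "\<exists>a b :: int. [1 + a ^ 4 + b ^ 4 = 0] (mod int p)"
proof -
  have "S (\<lambda>x. h 0 x * h 0 (- 1 - x)) \<noteq> 0" using t_000_nonzero[OF assms] by (simp add: t_def r_def)
  then obtain x where "h 0 x * h 0 (- 1 - x) \<noteq> 0" unfolding S_def by (meson sum.neutral)
  then have "h 0 x = 1" "h 0 (- 1 - x) = 1" using h_cases by force+
  then obtain a b where "[a ^ 4 = x] (mod int p)" "[b ^ 4 = - 1 - x] (mod int p)"
    using fourth_power_if_class_0 by blast
  then have "[1 + a ^ 4 + b ^ 4 = 1 + x + (- 1 - x)] (mod int p)" by (intro cong_add) auto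
  then show ?thesis by auto
qed

end

section \<open>Isotropy modulo p\<close>

text \<open>For a primitive root this power is a square root of 1 different from 1. It supplies the
  fourth root of -1 for \<open>p mod 8 = 1\<close> and the \<open>g\<close> of
  \<open>quartic_classes\<close>.\<close>

lemma minus_one_power_exists:
  assumes p: "prime p" "p > 2"
  shows "\<exists>g::int. [g ^ ((p - 1) div 2) = - 1] (mod int p)"
proof -
  obtain g where g: "residue_primroot p g" using prime_primitive_root_exists[OF prime_gt_1_nat] p(1) by blast
  define d where "d = (p - 1) div 2"
  have "odd p" using p prime_odd_nat by auto
  then have d: "p - 1 = 2 * d" "d > 0" unfolding d_def using p(2) by auto
  have ord: "ord p g = 2 * d" using g p(1) d by (simp add: residue_primroot_def totient_prime)
  have "[g ^ (2 * d) = 1] (mod p)" unfolding ord_divides ord by simp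
  then have "[int g ^ (2 * d) = 1] (mod int p)" by (metis cong_int_iff of_nat_1 of_nat_power)
  then have "int p dvd int g ^ (2 * d) - 1" by (simp add: cong_iff_dvd_diff)
  also have "int g ^ (2 * d) - 1 = (int g ^ d - 1) * (int g ^ d - (-1))"
    unfolding mult_2 power_add by (simp add: algebra_simps)
  finally have "int p dvd int g ^ d - 1 \<or> int p dvd int g ^ d - (-1)"
    using p(1) by (subst prime_dvd_mult_iff[symmetric]) auto
  moreover have "\<not> int p dvd int g ^ d - 1"
  proof
    assume "int p dvd int g ^ d - 1"
    then have "[int g ^ d = 1] (mod int p)" by (simp add: cong_iff_dvd_diff)
    then have "[g ^ d = 1] (mod p)" by (metis cong_int_iff of_nat_1 of_nat_power)
    then have "2 * d dvd d" unfolding ord_divides ord .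
    then show False using d(2) by (auto dest: dvd_imp_le)
  qed
  ultimately show ?thesis unfolding d_def cong_iff_dvd_diff by blast
qed

text \<open>Allows zeros to be given as lists of integers: signs vanish in fourth powers, and the
  index is moved from 0 to 1.\<close>

lemma isotropic_listI:
  assumes "int p dvd (\<Sum>x\<leftarrow>xs. x ^ 4)" "y \<in> set xs" "\<not> int p dvd y"
  shows "isotropic p (length xs)"
proof -
  define x where "x i = nat \<bar>xs ! (i - 1)\<bar>" for i
  have "int (\<Sum>i = 1..length xs. x i ^ 4) = (\<Sum>i<length xs. (xs ! i) ^ 4)"
    by (simp add: x_def sum.atLeast1_atMost_eq power_even_abs)
  also have "\<dots> = (\<Sum>x\<leftarrow>xs. x ^ 4)"
    by (simp add: sum_list_sum_nth atLeast0LessThan)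
  finally have "p dvd (\<Sum>i = 1..length xs. x i ^ 4)" using assms(1) by (metis int_dvd_int_iff)
  moreover obtain i where i: "i < length xs" "y = xs ! i" using assms(2) by (metis in_set_conv_nth)
  then have "\<not> int p dvd int (x (Suc i))" using assms(3) by (simp add: x_def)
  then have "\<not> p dvd x (Suc i)" by (simp only: int_dvd_int_iff not_False_eq_True)
  moreover have "Suc i \<in> {1..length xs}" using i by simp
  ultimately show ?thesis unfolding isotropic_def by blast
qed

lemma isotropic_mono:
  assumes "isotropic p m" "m \<le> n" "p > 0"
  shows "isotropic p n"
proof -
  obtain x i where x: "p dvd (\<Sum>i = 1..m. x i ^ 4)" "i \<in> {1..m}" "\<not> p dvd x i"
    using assms(1) unfolding isotropic_def by blast
  define y where "y j = (if j \<le> m then x j else 0)" for j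
  have "(\<Sum>j = 1..n. y j ^ 4) = (\<Sum>j = 1..m. x j ^ 4)"
    using assms(2) by (intro sum.mono_neutral_cong_right) (auto simp: y_def)
  moreover have "i \<in> {1..n}" "\<not> p dvd y i" using x assms(2) by (auto simp: y_def)
  ultimately show ?thesis using x(1) unfolding isotropic_def by metis
qed

text \<open>A nontrivial zero in two variables means that -1 is a fourth power modulo
  \<open>p\<close>.\<close>

lemma isotropic_two_iff:
  assumes p: "prime p" "p > 2"
  shows "isotropic p 2 \<longleftrightarrow> p mod 8 = 1"
proof
  have np: "\<not> int p dvd 1" "\<not> int p dvd 2" using p(2) zdvd_imp_le[of "int p" 1] zdvd_imp_le[of "int p" 2] by auto
  have "odd p" using p prime_odd_nat by auto
  {
    assume "isotropic p 2"
    then obtain x :: "nat \<Rightarrow> nat" and i where x: "p dvd (\<Sum>i = 1..2. x i ^ 4)" "i \<in> {1..2}" "\<not> p dvd x i"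
      unfolding isotropic_def by blast
    define a b where "a = int (x 1)" and "b = int (x 2)"
    have "(\<Sum>i = 1..2. x i ^ 4) = x 1 ^ 4 + x 2 ^ 4" by (simp add: numeral_2_eq_2)
    then have "int p dvd int (x 1 ^ 4 + x 2 ^ 4)" using x(1) by (simp only: int_dvd_int_iff)
    then have ab: "int p dvd a ^ 4 + b ^ 4" by (simp add: a_def b_def)
    have "i = 1 \<or> i = 2" using x(2) by auto
    then have "\<not> int p dvd a \<or> \<not> int p dvd b" using x(3) by (auto simp: a_def b_def)
    moreover have "int p dvd a ^ 4 \<longleftrightarrow> int p dvd b ^ 4" using ab
      by (metis dvd_add_left_iff dvd_add_right_iff)
    ultimately have units: "\<not> int p dvd a" "\<not> int p dvd b"
      using p(1) by (auto simp: prime_dvd_power_iff)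
    show "p mod 8 = 1"
    proof (rule ccontr)
      assume "p mod 8 \<noteq> 1"
      \<comment> \<open>Raising \<open>a ^ 4 = - (b ^ 4)\<close> to an odd power \<open>d\<close>
        with \<open>4 * d\<close> a multiple of \<open>p - 1\<close> yields \<open>1 = - 1\<close>
        by Fermat.\<close>
      then obtain d k where d: "odd d" "4 * d = (p - 1) * k"
      proof (cases "p mod 4 = 3")
        case True
        define k where "k = p div 4"
        have "p = 4 * k + 3" using True mult_div_mod_eq[of 4 p] by (simp add: k_def)
        then show ?thesis by (intro that[of "2 * k + 1" 2]) auto
      next
        case False
        have "p mod 8 = 5" using False \<open>p mod 8 \<noteq> 1\<close> \<open>odd p\<close> by presburger
        define k where "k = p div 8"
        have "p = 8 * k + 5" using \<open>p mod 8 = 5\<close> mult_div_mod_eq[of 8 p] by (simp add: k_def)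
        then show ?thesis by (intro that[of "2 * k + 1" 1]) auto
      qed
      have one: "[(c ^ 4) ^ d = 1] (mod int p)" if "\<not> int p dvd c" for c
        using cong_pow[OF fermat_theorem_int[OF p(1) that], of k]
        by (simp add: power_mult[symmetric] d(2))
      have "[a ^ 4 = - (b ^ 4)] (mod int p)" using ab by (simp add: cong_iff_dvd_diff)
      then have "[(a ^ 4) ^ d = (- (b ^ 4)) ^ d] (mod int p)" by (rule cong_pow)
      then have "[(a ^ 4) ^ d = - ((b ^ 4) ^ d)] (mod int p)" by (simp add: power_minus_odd[OF d(1)])
      moreover have "[- ((b ^ 4) ^ d) = - 1] (mod int p)"
        using one[OF units(2)] by (simp only: cong_minus_minus_iff)
      ultimately have "[1 = - 1] (mod int p)"
        using one[OF units(1)] cong_sym cong_trans by blast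
      then show False using np by (simp add: cong_iff_dvd_diff)
    qed
  }
  assume "p mod 8 = 1"
  define k where "k = p div 8"
  have "p = 8 * k + 1" using \<open>p mod 8 = 1\<close> mult_div_mod_eq[of 8 p] by (simp add: k_def)
  then have d: "(p - 1) div 2 = 4 * k" by simp
  obtain g :: int where "[g ^ ((p - 1) div 2) = - 1] (mod int p)"
    using minus_one_power_exists[OF p] by blast
  then have "[(g ^ k) ^ 4 = - 1] (mod int p)"
    unfolding d by (simp add: power_mult[symmetric] mult.commute)
  then have "isotropic p (length [1, g ^ k])"
    using np by (intro isotropic_listI[of _ _ 1]) (auto simp: cong_iff_dvd_diff add.commute)
  then show "isotropic p 2" by (simp add: numeral_2_eq_2)
qed

text \<open>Here \<open>-1\<close> is not a square, and every square is a fourth power. If \<open>n\<close> is the least quadratic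
  nonresidue, then \<open>n - 1\<close> and \<open>-n\<close> are squares, and \<open>1 + (n - 1) + (-n) = 0\<close>.\<close>

lemma isotropic_three_if_3_mod_4:
  assumes p: "prime p" "p mod 4 = 3"
  shows "isotropic p 3"
proof -
  let ?P = "int p"
  have "p \<ge> 3" using p(2) by presburger
  then have np: "\<not> ?P dvd 1" "\<not> ?P dvd 2"
    using zdvd_imp_le[of ?P 1] zdvd_imp_le[of ?P 2] by auto
  \<comment> \<open>\<open>q\<close> is \<open>(p + 1) / 4\<close>, so \<open>2 * q - 1\<close> is
    the odd exponent \<open>(p - 1) / 2\<close> of Euler's criterion, and the power \<open>q\<close>
    extracts square roots of squares.\<close>
  define q where "q = p div 4 + 1"
  have q: "p = 4 * q - 1" "q > 0" using p(2) mult_div_mod_eq[of 4 p] by (simp_all add: q_def)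
  then have q': "p - 1 = 2 * (2 * q - 1)" "p - 1 + 2 = 4 * q" "2 * q - 1 + 1 = 2 * q" by auto
  have odd: "odd (2 * q - 1)" using q(2) by simp
  define sq where "sq n \<longleftrightarrow> (\<exists>a::int. [a ^ 2 = n] (mod ?P))" for n
  have sqI: "sq n" if "[n ^ (2 * q - 1) = 1] (mod ?P)" for n
  proof -
    have "[n ^ (2 * q - 1) * n = 1 * n] (mod ?P)" using that by (rule cong_scalar_right)
    moreover have "n ^ (2 * q - 1) * n = (n ^ q) ^ 2"
      by (metis q'(3) power_add power_mult power_one_right mult.commute)
    ultimately show ?thesis unfolding sq_def by auto
  qed
  have fourth: "\<exists>c. [c ^ 4 = a ^ 2] (mod ?P)" for a :: int
  proof (cases "?P dvd a")
    case False
    have "[a ^ (p - 1) * a ^ 2 = 1 * a ^ 2] (mod ?P)"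
      using fermat_theorem_int[OF p(1) False] by (rule cong_scalar_right)
    moreover have "a ^ (p - 1) * a ^ 2 = (a ^ q) ^ 4"
      by (metis q'(2) power_add power_mult mult.commute)
    ultimately show ?thesis by auto
  next
    case True
    then have "[0 ^ 4 = a ^ 2] (mod ?P)" by (simp add: cong_iff_dvd_diff power2_eq_square)
    then show ?thesis by blast
  qed
  have not_sq_m1: "\<not> sq (- 1)"
  proof
    assume "sq (- 1)"
    then obtain a where a: "[a ^ 2 = - 1] (mod ?P)" unfolding sq_def by blast
    have "\<not> ?P dvd a"
    proof
      assume "?P dvd a"
      then have "[a ^ 2 = 0] (mod ?P)" by (simp add: cong_0_iff power2_eq_square)
      then have "[- 1 = 0] (mod ?P)" using a cong_sym cong_trans by blast
      then show False using np by (simp add: cong_0_iff)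
    qed
    then have "[a ^ (p - 1) = 1] (mod ?P)" by (rule fermat_theorem_int[OF p(1)])
    moreover have "[(a ^ 2) ^ (2 * q - 1) = (- 1) ^ (2 * q - 1)] (mod ?P)" using a by (rule cong_pow)
    then have "[a ^ (p - 1) = - 1] (mod ?P)"
      by (simp only: power_minus_odd[OF odd] q'(1) power_mult[symmetric] power_one)
    ultimately have "[1 = - 1] (mod ?P)" using cong_sym cong_trans by blast
    then show False using np by (simp add: cong_iff_dvd_diff)
  qed
  \<comment> \<open>This represents -1 by a natural number, so a least nonresidue exists.\<close>
  have "\<not> sq (int (p - 1))"
  proof
    assume "sq (int (p - 1))"
    moreover have "[int (p - 1) = - 1] (mod ?P)" using q by (simp add: cong_iff_dvd_diff of_nat_diff)
    ultimately show False using not_sq_m1 unfolding sq_def using cong_trans by blast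
  qed
  then obtain n where n: "\<not> sq (int n)" "\<And>m. m < n \<Longrightarrow> sq (int m)"
    using exists_least_iff[of "\<lambda>n. \<not> sq (int n)"] by blast
  have ndvd: "\<not> ?P dvd int n"
  proof
    assume "?P dvd int n"
    then have "[0 ^ 2 = int n] (mod ?P)" by (simp add: cong_iff_dvd_diff)
    then show False using n(1) unfolding sq_def by blast
  qed
  then have "n > 0" by (cases n) auto
  then have "sq (int n - 1)" using n(2)[of "n - 1"] by (simp add: of_nat_diff)
  then obtain a where a: "[a ^ 2 = int n - 1] (mod ?P)" unfolding sq_def by blast
  \<comment> \<open>Euler's criterion: the power \<open>2 * q - 1\<close> of the nonresidue
    \<open>n\<close> is -1, hence that of \<open>- n\<close> is 1 and \<open>- n\<close> is a
    square.\<close>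
  have "?P dvd int n ^ (p - 1) - 1"
    using fermat_theorem_int[OF p(1) ndvd] by (simp add: cong_iff_dvd_diff)
  also have "int n ^ (p - 1) - 1 = (int n ^ (2 * q - 1) - 1) * (int n ^ (2 * q - 1) + 1)"
    unfolding q'(1) by (simp only: mult_2 power_add) (simp add: algebra_simps)
  finally have "?P dvd int n ^ (2 * q - 1) - 1 \<or> ?P dvd int n ^ (2 * q - 1) + 1"
    using p(1) by (subst prime_dvd_mult_iff[symmetric]) auto
  moreover have "\<not> ?P dvd int n ^ (2 * q - 1) - 1"
    using n(1) sqI[of "int n"] unfolding cong_iff_dvd_diff by blast
  ultimately have "?P dvd - (int n ^ (2 * q - 1) + 1)" unfolding dvd_minus_iff by blast
  also have "- (int n ^ (2 * q - 1) + 1) = (- int n) ^ (2 * q - 1) - 1"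
    unfolding power_minus_odd[OF odd] by simp
  finally have "sq (- int n)" by (intro sqI) (simp add: cong_iff_dvd_diff)
  then obtain b where b: "[b ^ 2 = - int n] (mod ?P)" unfolding sq_def by blast
  obtain c d where "[c ^ 4 = a ^ 2] (mod ?P)" "[d ^ 4 = b ^ 2] (mod ?P)" using fourth by blast
  then have "[c ^ 4 = int n - 1] (mod ?P)" "[d ^ 4 = - int n] (mod ?P)"
    using a b cong_trans by blast+
  then have "[1 + (c ^ 4 + d ^ 4) = 1 + ((int n - 1) + - int n)] (mod ?P)"
    by (intro cong_add) auto
  then have "isotropic p (length [1, c, d])"
    using np by (intro isotropic_listI[of _ _ 1]) (auto simp: cong_0_iff)
  then show ?thesis by (simp add: numeral_3_eq_3)
qed

lemma isotropic_three:
  assumes p: "prime p" "p > 2" "p \<noteq> 5" "p \<noteq> 29"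
  shows "isotropic p 3"
proof -
  have "odd p" using p prime_odd_nat by auto
  then have "p mod 4 = 3 \<or> p mod 8 = 1 \<or> p mod 8 = 5" by presburger
  then consider "p mod 4 = 3" | "p mod 8 = 1" | "p mod 8 = 5" by blast
  then show ?thesis
  proof cases
    case 1
    then show ?thesis using isotropic_three_if_3_mod_4 p(1) by blast
  next
    case 2
    then show ?thesis using isotropic_two_iff[OF p(1,2)] isotropic_mono[of p 2 3] p(2) by simp
  next
    case 3
    define f where "f = 2 * (p div 8) + 1"
    have f: "p = 4 * f + 1" using 3 mult_div_mod_eq[of 8 p] by (simp add: f_def)
    then have f': "odd f" "(p - 1) div 2 = 2 * f" by (simp_all add: f_def)
    obtain g :: int where "[g ^ (2 * f) = - 1] (mod int p)"
      using minus_one_power_exists[OF p(1,2)] unfolding f'(2) by blast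
    then interpret quartic_classes p f g using p(1) f f'(1) by unfold_locales
    obtain a b :: int where "[1 + a ^ 4 + b ^ 4 = 0] (mod int p)"
      using three_fourth_powers p by blast
    then have "isotropic p (length [1, a, b])"
      using p_gt_1 by (intro isotropic_listI[of _ _ 1]) (auto simp: cong_0_iff add.assoc)
    then show ?thesis by (simp add: numeral_3_eq_3)
  qed
qed

section \<open>The exceptional primes 5 and 29\<close>

text \<open>Fourth powers are 0 or 1 modulo 5, so the residues of four of them add up to at most
  4.\<close>

lemma anisotropic_5_4: "\<not> isotropic 5 4"
proof
  assume "isotropic 5 4"
  then obtain x :: "nat \<Rightarrow> nat" and i where x: "5 dvd (\<Sum>i = 1..4. x i ^ 4)" "i \<in> {1..4}" "\<not> 5 dvd x i"
    unfolding isotropic_def by blast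
  have v: "x j ^ 4 mod 5 = of_bool (\<not> 5 dvd x j)" for j
  proof -
    have "x j mod 5 \<in> {0, 1, 2, 3, 4}" by auto
    then have "(x j mod 5) ^ 4 mod 5 = of_bool (x j mod 5 \<noteq> 0)" by auto
    then show ?thesis by (simp add: power_mod dvd_eq_mod_eq_0)
  qed
  have "(\<Sum>i = 1..4. x i ^ 4) = x 1 ^ 4 + x 2 ^ 4 + x 3 ^ 4 + x 4 ^ 4"
    by (simp add: eval_nat_numeral)
  then have d: "5 dvd x 1 ^ 4 + x 2 ^ 4 + x 3 ^ 4 + x 4 ^ 4" using x(1) by simp
  define S where "S = x 1 ^ 4 mod 5 + x 2 ^ 4 mod 5 + x 3 ^ 4 mod 5 + x 4 ^ 4 mod 5"
  have "[S = x 1 ^ 4 + x 2 ^ 4 + x 3 ^ 4 + x 4 ^ 4] (mod 5)"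
    unfolding S_def by (intro cong_add) simp_all
  then have "S mod 5 = 0" using d unfolding cong_def dvd_eq_mod_eq_0 by argo
  moreover have "x j ^ 4 mod 5 \<le> 1" for j by (simp add: v)
  then have "S \<le> 1 + 1 + 1 + 1" unfolding S_def by (intro add_mono)
  ultimately have "S = 0" by simp
  then have "\<forall>j\<in>{1, 2, 3, 4}. x j ^ 4 mod 5 = 0" unfolding S_def by auto
  then have "\<forall>j\<in>{1, 2, 3, 4}. 5 dvd x j" by (simp add: v)
  moreover have "i \<in> {1, 2, 3, 4}" using x(2) by auto
  ultimately show False using x(3) by blast
qed

lemma anisotropic_29_3: "\<not> isotropic 29 3"
proof
  assume "isotropic 29 3"
  then obtain x :: "nat \<Rightarrow> nat" and i where x: "29 dvd (\<Sum>i = 1..3. x i ^ 4)" "i \<in> {1..3}" "\<not> 29 dvd x i"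
    unfolding isotropic_def by blast
  \<comment> \<open>Zero and the seven nonzero fourth powers modulo 29; no nontrivial triple of them
    has sum 0.\<close>
  define R :: "nat list" where "R = [0, 1, 7, 16, 20, 23, 24, 25]"
  have v: "x j ^ 4 mod 29 \<in> set R" for j
  proof -
    have "\<forall>y\<in>{..<29}. y ^ 4 mod 29 \<in> set [0, 1, 7, 16, 20, 23, 24, 25 :: nat]"
      by (simp add: lessThan_nat_numeral lessThan_Suc)
    moreover have "x j mod 29 \<in> {..<29}" by simp
    ultimately have "(x j mod 29) ^ 4 mod 29 \<in> set R" unfolding R_def by blast
    then show ?thesis by (simp add: power_mod)
  qed
  have R: "\<forall>a\<in>set R. \<forall>b\<in>set R. \<forall>c\<in>set R. (a + b + c) mod 29 = 0 \<longrightarrow> a = 0 \<and> b = 0 \<and> c = 0"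
    unfolding R_def by simp
  have "(\<Sum>i = 1..3. x i ^ 4) = x 1 ^ 4 + x 2 ^ 4 + x 3 ^ 4" by (simp add: eval_nat_numeral)
  then have "(x 1 ^ 4 + x 2 ^ 4 + x 3 ^ 4) mod 29 = 0" using x(1) by simp
  moreover have "[x 1 ^ 4 mod 29 + x 2 ^ 4 mod 29 + x 3 ^ 4 mod 29 = x 1 ^ 4 + x 2 ^ 4 + x 3 ^ 4] (mod 29)"
    by (intro cong_add) simp_all
  ultimately have "(x 1 ^ 4 mod 29 + x 2 ^ 4 mod 29 + x 3 ^ 4 mod 29) mod 29 = 0"
    unfolding cong_def by argo
  then have "x 1 ^ 4 mod 29 = 0 \<and> x 2 ^ 4 mod 29 = 0 \<and> x 3 ^ 4 mod 29 = 0"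
    by (rule R[THEN bspec, OF v, THEN bspec, OF v, THEN bspec, OF v, THEN mp])
  then have "\<forall>j\<in>{1, 2, 3}. x j ^ 4 mod 29 = 0" by simp
  moreover have "i \<in> {1, 2, 3}" using x(2) by auto
  ultimately have "29 dvd x i ^ 4" unfolding dvd_eq_mod_eq_0 by (rule bspec)
  moreover have "prime (29::nat)" by simp
  ultimately show False using x(3) prime_dvd_power by blast
qed

theorem theorem1p13:
  fixes p :: nat
  assumes "prime p" and "p > 2"
  shows "(dense_in_Qp p (ratio_set (sums_fourth_powers 2)) \<longleftrightarrow> [p = 1] (mod 8)) \<and>
         (dense_in_Qp p (ratio_set (sums_fourth_powers 3)) \<longleftrightarrow> p \<noteq> 5 \<and> p \<noteq> 29) \<and>
         (dense_in_Qp p (ratio_set (sums_fourth_powers 4)) \<longleftrightarrow> p \<noteq> 5) \<and>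
         (\<forall>m\<ge>5. dense_in_Qp p (ratio_set (sums_fourth_powers m)))"
proof -
  have dense_iff: "dense_in_Qp p (ratio_set (sums_fourth_powers m)) \<longleftrightarrow> isotropic p m" for m
    using dense_if_isotropic[OF assms] isotropic_if_dense[OF assms(1)] by blast
  have mono: "isotropic p m \<Longrightarrow> m \<le> n \<Longrightarrow> isotropic p n" for m n
    using isotropic_mono assms(2) by simp
  \<comment> \<open>Modulo 29 the fourth powers of 8 and 6 are 7 and 20, and
    \<open>1 + 1 + 7 + 20 = 29\<close>.\<close>
  have iso29: "isotropic 29 4"
    using isotropic_listI[of 29 "[1, 1, 8, 6]" 1] by (simp add: eval_nat_numeral)
  have iso5: "isotropic 5 5"
    using isotropic_listI[of 5 "[1, 1, 1, 1, 1]" 1] by (simp add: eval_nat_numeral)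
  have "isotropic p 3 \<longleftrightarrow> p \<noteq> 5 \<and> p \<noteq> 29"
    using isotropic_three[OF assms] anisotropic_29_3 anisotropic_5_4 mono[of 3 4] by auto
  moreover from this have four: "isotropic p 4 \<longleftrightarrow> p \<noteq> 5"
    using iso29 anisotropic_5_4 mono[of 3 4] by auto
  moreover have "isotropic p m" if "m \<ge> 5" for m
    using four iso5 mono[of 4 m] mono[of 5 m] that by auto
  moreover have "[p = 1] (mod 8) \<longleftrightarrow> p mod 8 = 1" by (simp add: cong_def)
  ultimately show ?thesis
    unfolding dense_iff using isotropic_two_iff[OF assms] by blast
qed

end
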